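(* With notation as in the context, for every $g\in\overline{\widetilde{\mathbb M}}$ (closure in $\mathbb G$), $$d(g)^2=\sup_{\tau\in\Omega_*}\phi(g;\tau).$$
   Context: Let $q,m\ge1$, $U^{(1)},\dots,U^{(m)}$ linearly independent real skew-symmetric $q\times q$ matrices; $\mathbb G=\mathbb R^q\times\mathbb R^m$ with law $(x,t)\cdot(x',t')=(x+x',t+t'+\frac12\langle\mathbb Ux,x'\rangle)$, $\langle\mathbb Ux,x'\rangle=(\langle U^{(j)}x,x'\rangle)_j$, identity $o$; $d(g)$ is the Carnot–Carathéodory distance from $o$ (infimum of $\int_0^1|x'|$ over absolutely continuous curves from $o$ to $g$ with $t'=\frac12\langle\mathbb Ux,x'\rangle$). $U(\tau)=i\sum_j\tau_jU^{(j)}$, $\Omega_*=\{\tau:\|U(\tau)\|<\pi\}$, $\phi((x,t);\tau)=\langle U(\tau)\cot U(\tau)x,x\rangle+4t\cdot\tau$. $\widetilde{\mathbb M}=\{g:\phi(g;\cdot)$ attains its maximum in $\Omega_*\}$. *)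

theory Defs
  imports "HOL-Analysis.Analysis"
begin

definition abs_cont_on :: "real \<Rightarrow> real \<Rightarrow> (real \<Rightarrow> 'a::real_normed_vector) \<Rightarrow> bool" where
  "abs_cont_on a b f \<longleftrightarrow>
     (\<forall>\<epsilon>>0. \<exists>\<delta>>0. \<forall>(n::nat) (l::nat \<Rightarrow> real) (r::nat \<Rightarrow> real).
        (\<forall>k<n. a \<le> l k \<and> l k \<le> r k \<and> r k \<le> b) \<and>
        (\<forall>i<n. \<forall>j<n. i \<noteq> j \<longrightarrow> r i \<le> l j \<or> r j \<le> l i) \<and>
        (\<Sum>k<n. r k - l k) < \<delta>
        \<longrightarrow> (\<Sum>k<n. norm (f (r k) - f (l k))) < \<epsilon>)"

definition gmult :: "('m \<Rightarrow> real^'q^'q) \<Rightarrow> ((real^'q) \<times> (real^'m)) \<Rightarrow> ((real^'q) \<times> (real^'m)) \<Rightarrow> ((real^'q) \<times> (real^'m))" where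
  "gmult U g g' = (fst g + fst g', snd g + snd g' + (\<chi> j. (1/2) * ((U j *v fst g) \<bullet> fst g')))"

definition horizontal_curve ::
  "('m::finite \<Rightarrow> real^'q^'q) \<Rightarrow> ((real^'q) \<times> (real^'m)) \<Rightarrow> (real \<Rightarrow> (real^'q) \<times> (real^'m)) \<Rightarrow> (real \<Rightarrow> real^'q) \<Rightarrow> bool" where
  "horizontal_curve U g \<gamma> v \<longleftrightarrow>
     abs_cont_on 0 1 \<gamma> \<and> \<gamma> 0 = (0, 0) \<and> \<gamma> 1 = g \<and>
     (AE s in lebesgue. s \<in> {0..1} \<longrightarrow>
        ((\<lambda>r. fst (\<gamma> r)) has_vector_derivative v s) (at s) \<and>
        ((\<lambda>r. snd (\<gamma> r)) has_vector_derivative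
            (\<chi> j. (1/2) * ((U j *v fst (\<gamma> s)) \<bullet> v s))) (at s)) \<and>
     (\<lambda>s. norm (v s)) integrable_on {0..1}"

definition cc_dist :: "('m::finite \<Rightarrow> real^'q^'q) \<Rightarrow> ((real^'q) \<times> (real^'m)) \<Rightarrow> real" where
  "cc_dist U g = Inf {integral {0..1} (\<lambda>s. norm (v s)) | \<gamma> v. horizontal_curve U g \<gamma> v}"

definition Umat :: "('m::finite \<Rightarrow> real^'q^'q) \<Rightarrow> real^'m \<Rightarrow> complex^'q^'q" where
  "Umat U \<tau> = (\<chi> a b. \<i> * complex_of_real (\<Sum>j\<in>UNIV. \<tau> $ j * (U j $ a $ b)))"

definition mat_opnorm :: "complex^'q^'q \<Rightarrow> real" where
  "mat_opnorm A = onorm (\<lambda>v. A *v v)"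

text \<open>Functional calculus for diagonalisable (e.g. Hermitian) matrices: f(A) is the matrix acting
  as multiplication by f(mu) on each eigenvector of A with eigenvalue mu.\<close>
definition mat_fun :: "(complex \<Rightarrow> complex) \<Rightarrow> complex^'q^'q \<Rightarrow> complex^'q^'q" where
  "mat_fun f A = (THE M. \<forall>v \<mu>. A *v v = \<mu> *s v \<longrightarrow> M *v v = f \<mu> *s v)"

text \<open>z cot z, extended continuously by 1 at z = 0.\<close>
definition zcot :: "complex \<Rightarrow> complex" where
  "zcot z = (if z = 0 then 1 else z * cot z)"

definition Omega_star :: "('m::finite \<Rightarrow> real^'q^'q) \<Rightarrow> (real^'m) set" where
  "Omega_star U = {\<tau>. mat_opnorm (Umat U \<tau>) < pi}"

definition phi :: "('m::finite \<Rightarrow> real^'q^'q) \<Rightarrow> ((real^'q) \<times> (real^'m)) \<Rightarrow> real^'m \<Rightarrow> real" where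
  "phi U g \<tau> =
     Re (\<Sum>i\<in>UNIV. (mat_fun zcot (Umat U \<tau>) *v (\<chi> k. complex_of_real (fst g $ k))) $ i
                    * cnj (complex_of_real (fst g $ i)))
     + 4 * (snd g \<bullet> \<tau>)"

definition Mtilde :: "('m::finite \<Rightarrow> real^'q^'q) \<Rightarrow> ((real^'q) \<times> (real^'m)) set" where
  "Mtilde U = {g. \<exists>\<tau>\<in>Omega_star U. \<forall>\<sigma>\<in>Omega_star U. phi U g \<sigma> \<le> phi U g \<tau>}"

end

theory Submission
  imports Defs
begin

text \<open>
  Put \<open>A = \<Sum>\<^sub>j \<tau>\<^sub>j U\<^sub>j\<close>. Along a horizontal curve to \<open>(x, t)\<close> one has \<open>4 t \<bullet> \<tau> = 2 \<integral> \<langle>A x, x'\<rangle>\<close>, so a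
  curve of constant speed and length \<open>L\<close> satisfies \<open>L\<^sup>2 = \<integral> (\<bar>x'\<bar>\<^sup>2 - 2 \<langle>A x, x'\<rangle>) + 4 t \<bullet> \<tau>\<close>. For
  \<open>\<parallel>A\<parallel> < \<pi>\<close> the minimum of this integral with endpoint \<open>x\<close> fixed is \<open>\<langle>U(\<tau>) cot U(\<tau>) x, x\<rangle>\<close>, attained
  by the solution of \<open>\<xi>' = w + 2 A \<xi>\<close>, \<open>\<xi> 0 = 0\<close>, \<open>\<xi> 1 = x\<close>; minimality is shown by a calibration on
  polygons, which approximate any absolutely continuous curve. Hence \<open>phi U g \<tau> \<le> d(g)\<^sup>2\<close> on
  \<open>Omega_star U\<close>.

  If \<open>\<tau>\<close> is an interior maximum, the envelope inequality forces the extremal to end exactly at \<open>g\<close>,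
  so that \<open>d(g)\<^sup>2 \<le> \<bar>w\<bar>\<^sup>2 = phi U g \<tau>\<close>. For \<open>g\<close> in the closure, such extremals subconverge to one
  ending at \<open>g\<close>; its parameter may lie on the boundary of \<open>Omega_star U\<close>, but
  \<open>phi U g (\<rho> \<tau>) \<ge> \<rho> phi U g \<tau>\<close> for \<open>0 < \<rho> < 1\<close> (the cotangent decreases) shows that the
  supremum still reaches \<open>\<bar>w\<bar>\<^sup>2\<close>.
\<close>

section \<open>Eigenbases of squares of skew maps\<close>

text \<open>Two obstacles shape the argument. The velocity of a horizontal curve is only integrable,
  so the energy integral need not be finite along it. The calibration is therefore applied to
  inscribed polygons, each parametrised proportionally to its own length, and absolute continuity
  serves to compare arcs with chords. Moreover \<open>real_zcot\<close> blows up at \<pi>, so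
  \<open>phi\<close> cannot be followed to the boundary of \<open>Omega_star U\<close>. The endpoint
  (\<open>xi \<tau> w 1\<close>, \<open>tend \<tau> w\<close>), in contrast, is defined and
  sequentially continuous for all \<tau> and w, and limits are taken there; values of
  \<open>phi\<close> at nearby points are compared only at rescaled parameters, of norm at most
  \<open>\<rho> * pi\<close>. The gradient of \<open>phi\<close> is never computed: the eigenbasis
  that expresses \<open>phi\<close> is chosen separately at every \<tau>, and no regularity of this
  choice is claimed.\<close>

lemma linear_coeff_zero_if_quadratic_nonneg:
  fixes b q :: real
  assumes "\<And>s. 0 \<le> 2 * s * b + s\<^sup>2 * q"
  shows "b = 0"
proof (rule ccontr)
  assume b: "b \<noteq> 0"
  \<comment> \<open>With this \<open>s\<close> the factor \<open>2 * b + s * q\<close> is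
    \<open>b\<close> times a positive number, while \<open>s\<close> has the opposite sign to
    \<open>b\<close>.\<close>
  define s where "s = - b / (1 + \<bar>q\<bar>)"
  have "s * (2 * b + s * q) = 2 * s * b + s\<^sup>2 * q" by (simp add: power2_eq_square algebra_simps)
  with assms[of s] have *: "0 \<le> s * (2 * b + s * q)" by simp
  have "2 * b + s * q = b * (2 - q / (1 + \<bar>q\<bar>))"
    by (simp add: s_def algebra_simps)
  then have "s * (2 * b + s * q) = - (b\<^sup>2 * (2 - q / (1 + \<bar>q\<bar>)) / (1 + \<bar>q\<bar>))"
    by (simp only:) (simp add: s_def power2_eq_square)
  moreover have "q / (1 + \<bar>q\<bar>) < 2" by (simp add: field_simps)
  ultimately show False
    using * b by (smt (verit) divide_pos_pos mult_pos_pos zero_less_power2)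
qed

text \<open>Rayleigh quotient: a maximiser of \<open>f x \<bullet> x\<close> on the unit sphere of
  \<open>S\<close> is an eigenvector, and by symmetry its orthogonal complement within
  \<open>S\<close> is again invariant, so induction on the dimension applies. Letting
  \<open>S\<close> vary keeps the induction inside one type.\<close>

lemma symmetric_eigenbasis_subspace:
  fixes f :: "'a::euclidean_space \<Rightarrow> 'a"
  assumes lin: "linear f" and sym: "\<And>x y. f x \<bullet> y = x \<bullet> f y"
    and "subspace S" and "\<And>x. x \<in> S \<Longrightarrow> f x \<in> S"
  shows "\<exists>B. B \<subseteq> S \<and> finite B \<and> pairwise orthogonal B \<and> (\<forall>e\<in>B. norm e = 1) \<and>
    span B = S \<and> (\<forall>e\<in>B. \<exists>\<mu>. f e = \<mu> *\<^sub>R e)"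
  using assms(3,4)
proof (induction "dim S" arbitrary: S rule: less_induct)
  case less
  note S = less.prems(1) and inv = less.prems(2)
  show ?case
  proof (cases "S = {0}")
    case True
    then show ?thesis by (intro exI[of _ "{}"]) simp
  next
    case False
    then obtain y0 where y0: "y0 \<in> S" "y0 \<noteq> 0" using subspace_0[OF S] by auto
    let ?K = "S \<inter> sphere 0 1"
    have K: "compact ?K" by (intro closed_Int_compact closed_subspace S compact_sphere)
    have Kne: "y0 /\<^sub>R norm y0 \<in> ?K" using y0 S by (simp add: subspace_scale)
    have fc: "continuous_on X f" for X
      using linear_continuous_on[OF linear_conv_bounded_linear[THEN iffD1, OF lin]] .
    have "continuous_on ?K (\<lambda>x. f x \<bullet> x)" by (intro continuous_intros fc)
    from continuous_attains_sup[OF K _ this] Kne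
    obtain e where e: "e \<in> ?K" and emax: "\<And>y. y \<in> ?K \<Longrightarrow> f y \<bullet> y \<le> f e \<bullet> e" by blast
    define \<mu> where "\<mu> = f e \<bullet> e"
    have eS: "e \<in> S" and e1: "norm e = 1" and ee: "e \<bullet> e = 1" using e by (auto simp: norm_eq_1)
    have Q: "f y \<bullet> y \<le> \<mu> * (y \<bullet> y)" if "y \<in> S" for y
    proof (cases "y = 0")
      case True then show ?thesis by simp
    next
      case False
      have "y /\<^sub>R norm y \<in> ?K" using False that S by (simp add: subspace_scale)
      from emax[OF this] have "f y \<bullet> y / (norm y)\<^sup>2 \<le> \<mu>"
        by (simp add: \<mu>_def linear_scale[OF lin] power2_eq_square divide_simps)
      then show ?thesis using False by (simp add: divide_simps power2_norm_eq_inner)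
    qed
    \<comment> \<open>The form \<open>\<mu> * (y \<bullet> y) - f y \<bullet> y\<close> is
      nonnegative on \<open>S\<close> and vanishes at \<open>e\<close>; hence its first variation at
      \<open>e\<close> vanishes.\<close>
    have ort: "(\<mu> *\<^sub>R e - f e) \<bullet> y = 0" if "y \<in> S" for y
    proof (rule linear_coeff_zero_if_quadratic_nonneg)
      fix s :: real
      have "e + s *\<^sub>R y \<in> S" using eS that S by (simp add: subspace_add subspace_scale)
      from Q[OF this] have "0 \<le> \<mu> * ((e + s *\<^sub>R y) \<bullet> (e + s *\<^sub>R y)) - f (e + s *\<^sub>R y) \<bullet> (e + s *\<^sub>R y)"
        by simp
      also have "\<dots> = 2 * s * ((\<mu> *\<^sub>R e - f e) \<bullet> y) + s\<^sup>2 * (\<mu> * (y \<bullet> y) - f y \<bullet> y)"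
        using sym[of y e] ee
        by (simp add: linear_add[OF lin] linear_scale[OF lin] inner_simps \<mu>_def
            power2_eq_square algebra_simps inner_commute)
      finally show "0 \<le> 2 * s * ((\<mu> *\<^sub>R e - f e) \<bullet> y) + s\<^sup>2 * (\<mu> * (y \<bullet> y) - f y \<bullet> y)" .
    qed
    have "\<mu> *\<^sub>R e - f e \<in> S" using eS inv S by (simp add: subspace_diff subspace_scale)
    from ort[OF this] have fe: "f e = \<mu> *\<^sub>R e" by simp
    define S' where "S' = S \<inter> {y. e \<bullet> y = 0}"
    have S': "subspace S'" unfolding S'_def by (intro subspace_inter S subspace_hyperplane)
    have inv': "f x \<in> S'" if "x \<in> S'" for x
      using that inv sym[of e x] by (auto simp: S'_def fe)
    have "e \<notin> S'" using ee by (simp add: S'_def)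
    then have "S' \<subset> S" using eS unfolding S'_def by blast
    then have "dim S' < dim S" by (metis S S' dim_psubset span_eq_iff)
    from less.hyps[OF this S' inv'] obtain B where B: "B \<subseteq> S'" "finite B" "pairwise orthogonal B"
      "\<forall>b\<in>B. norm b = 1" "span B = S'" "\<forall>b\<in>B. \<exists>\<mu>. f b = \<mu> *\<^sub>R b" by blast
    have "span (insert e B) = S"
    proof
      show "span (insert e B) \<subseteq> S"
        using eS B(1) S by (intro span_minimal) (auto simp: S'_def)
      show "S \<subseteq> span (insert e B)"
      proof
        fix y assume y: "y \<in> S"
        have "y - (e \<bullet> y) *\<^sub>R e \<in> S'"
          using y eS S ee by (simp add: S'_def subspace_diff subspace_scale inner_simps)
        then show "y \<in> span (insert e B)" using B(5) by (auto simp: span_insert)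
      qed
    qed
    moreover have "pairwise orthogonal (insert e B)"
      using B(1,3) by (auto simp: pairwise_insert S'_def orthogonal_def inner_commute)
    ultimately show ?thesis
      using B eS e1 fe by (intro exI[of _ "insert e B"]) (auto simp: S'_def)
  qed
qed

text \<open>A real substitute for diagonalising the Hermitian matrix i A: the vectors diagonalise
  the square of \<open>A\<close>, and \<open>l e\<close> is the absolute value of the corresponding
  eigenvalues of i A. This is enough for even functions such as \<open>zcot\<close>. Completeness is
  an expansion formula because later formulas are sums over \<open>B\<close>.\<close>

definition skew_eigenbasis :: "('a::real_inner \<Rightarrow> 'a) \<Rightarrow> 'a set \<Rightarrow> ('a \<Rightarrow> real) \<Rightarrow> bool" where
  "skew_eigenbasis A B l \<longleftrightarrow> finite B \<and> pairwise orthogonal B \<and>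
     (\<forall>e\<in>B. norm e = 1 \<and> A (A e) = - (l e)\<^sup>2 *\<^sub>R e \<and> norm (A e) = l e) \<and>
     (\<forall>x. (\<Sum>e\<in>B. (x \<bullet> e) *\<^sub>R e) = x)"

lemma skew_eigenbasisD:
  assumes "skew_eigenbasis A B l"
  shows "finite B" "pairwise orthogonal B" "\<And>e. e \<in> B \<Longrightarrow> norm e = 1"
    "\<And>e. e \<in> B \<Longrightarrow> A (A e) = - (l e)\<^sup>2 *\<^sub>R e" "\<And>e. e \<in> B \<Longrightarrow> norm (A e) = l e"
    "\<And>x. (\<Sum>e\<in>B. (x \<bullet> e) *\<^sub>R e) = x"
  using assms by (auto simp: skew_eigenbasis_def)

lemma skew_eigenbasis_exists:
  fixes A :: "'a::euclidean_space \<Rightarrow> 'a"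
  assumes lin: "linear A" and skew: "\<And>x y. A x \<bullet> y = - (x \<bullet> A y)"
  shows "\<exists>B l. skew_eigenbasis A B l"
proof -
  have "linear (\<lambda>x. A (A x))" using linear_compose[OF lin lin] by (simp add: comp_def)
  from symmetric_eigenbasis_subspace[OF this, of UNIV] skew
  obtain B where B: "finite B" "pairwise orthogonal B" "\<forall>e\<in>B. norm e = 1" "span B = UNIV"
    "\<forall>e\<in>B. \<exists>\<mu>. A (A e) = \<mu> *\<^sub>R e" by auto
  have "A (A e) = - (norm (A e))\<^sup>2 *\<^sub>R e" if e: "e \<in> B" for e
  proof -
    obtain \<mu> where \<mu>: "A (A e) = \<mu> *\<^sub>R e" using B(5) e by blast
    have "e \<bullet> e = 1" using B(3) e by (auto simp: norm_eq_1)
    then have "\<mu> = - (norm (A e))\<^sup>2"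
      using skew[of "A e" e] by (simp add: \<mu> power2_norm_eq_inner)
    then show ?thesis using \<mu> by simp
  qed
  moreover have "(\<Sum>e\<in>B. (x \<bullet> e) *\<^sub>R e) = x" for x
    using orthonormal_basis_expand[OF B(2) _ _ B(1), of x] B(3,4) by (simp add: inner_commute)
  ultimately show ?thesis using B unfolding skew_eigenbasis_def
    by (intro exI[of _ B] exI[of _ "\<lambda>e. norm (A e)"]) auto
qed

section \<open>Spectral formula for phi\<close>

definition real_zcot :: "real \<Rightarrow> real" where
  "real_zcot l = (if l = 0 then 1 else l * cot l)"

lemma zcot_of_real: "zcot (complex_of_real l) = complex_of_real (real_zcot l)"
  by (simp add: zcot_def real_zcot_def cot_of_real)

lemma zcot_minus: "zcot (- z) = zcot z"
  by (simp add: zcot_def)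

definition cvec :: "real^'n \<Rightarrow> complex^'n" where
  "cvec x = (\<chi> k. complex_of_real (x $ k))"

text \<open>Since \<open>e\<close> is real, this is the Hermitian product with \<open>e\<close>,
  written without a conjugate.\<close>

definition cdot :: "real^'n::finite \<Rightarrow> complex^'n \<Rightarrow> complex" where
  "cdot e v = (\<Sum>i\<in>UNIV. v $ i * complex_of_real (e $ i))"

lemma cdot_scaleR: "cdot (r *\<^sub>R e) v = complex_of_real r * cdot e v"
  by (simp add: cdot_def sum_distrib_left mult_ac)

lemma cdot_cmul: "cdot e (c *s v) = c * cdot e v"
  by (simp add: cdot_def sum_distrib_left mult_ac)

definition imat :: "real^'n^'n \<Rightarrow> complex^'n^'n" where
  "imat K = (\<chi> a b. \<i> * complex_of_real (K $ a $ b))"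

lemma imat_cvec: "imat K *v cvec x = \<i> *s cvec (K *v x)"
  by (simp add: vec_eq_iff imat_def cvec_def matrix_vector_mult_def sum_distrib_left mult_ac)

lemma transpose_uminus_nth:
  fixes K :: "real^'n^'n"
  assumes "transpose K = - K"
  shows "K $ i $ j = - K $ j $ i"
proof -
  have "transpose K $ j $ i = (- K) $ j $ i" by (simp only: assms)
  then show ?thesis by (simp add: transpose_def)
qed

lemma cdot_imat:
  fixes K :: "real^'n::finite^'n"
  assumes "transpose K = - K"
  shows "cdot e (imat K *v v) = - \<i> * cdot (K *v e) v"
proof -
  have "cdot e (imat K *v v) = (\<Sum>i\<in>UNIV. \<Sum>j\<in>UNIV. \<i> * (v $ j * of_real (K $ i $ j * e $ i)))"
    by (simp add: cdot_def imat_def matrix_vector_mult_def sum_distrib_left sum_distrib_right mult_ac)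
  also have "\<dots> = (\<Sum>j\<in>UNIV. \<Sum>i\<in>UNIV. \<i> * (v $ j * of_real (K $ i $ j * e $ i)))"
    by (rule sum.swap)
  also have "\<dots> = (\<Sum>j\<in>UNIV. \<Sum>i\<in>UNIV. - \<i> * (v $ j * of_real (K $ j $ i * e $ i)))"
  proof (intro sum.cong refl)
    fix i j
    show "\<i> * (v $ j * of_real (K $ i $ j * e $ i)) = - \<i> * (v $ j * of_real (K $ j $ i * e $ i))"
      using transpose_uminus_nth[OF assms, of i j] by simp
  qed
  also have "\<dots> = - \<i> * cdot (K *v e) v"
    by (simp add: cdot_def matrix_vector_mult_def sum_distrib_left sum_distrib_right sum_negf mult_ac)
  finally show ?thesis .
qed

text \<open>Completeness in coordinates; it recovers a matrix from its action on
  \<open>B\<close>.\<close>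

lemma orthonormal_basis_kernel:
  fixes B :: "(real^'n::finite) set"
  assumes "\<And>x. (\<Sum>e\<in>B. (x \<bullet> e) *\<^sub>R e) = x"
  shows "(\<Sum>e\<in>B. e $ i * e $ j) = (if i = j then 1 else 0)"
proof -
  have "(\<Sum>e\<in>B. (axis j 1 \<bullet> e) *\<^sub>R e) $ i = axis j (1::real) $ i" by (simp only: assms)
  then show ?thesis by (simp add: inner_axis' mult.commute[of "_ $ j"]) (simp add: axis_def)
qed

lemma cdot_expand:
  fixes B :: "(real^'n::finite) set"
  assumes "\<And>x. (\<Sum>e\<in>B. (x \<bullet> e) *\<^sub>R e) = x"
  shows "(\<Sum>e\<in>B. cdot e v * complex_of_real (e $ i)) = v $ i"
proof -
  have "(\<Sum>e\<in>B. cdot e v * complex_of_real (e $ i))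
      = (\<Sum>e\<in>B. \<Sum>k\<in>UNIV. v $ k * complex_of_real (e $ k * e $ i))"
    by (simp add: cdot_def sum_distrib_left sum_distrib_right mult_ac)
  also have "\<dots> = (\<Sum>k\<in>UNIV. v $ k * complex_of_real (\<Sum>e\<in>B. e $ k * e $ i))"
    by (subst sum.swap) (simp add: sum_distrib_left)
  also have "\<dots> = v $ i"
    by (simp add: orthonormal_basis_kernel[OF assms] if_distrib sum.delta cong: if_cong)
  finally show ?thesis .
qed

text \<open>A vector \<open>e\<close> of the basis need not be an eigenvector of
  \<open>imat K\<close>, but it lies in the sum of the eigenspaces for plus and minus
  \<open>l e\<close>, where an even \<open>f\<close> takes a single value. Because
  \<open>mat_fun\<close> is a definite description, the proof shows both that this matrix acts
  correctly on every eigenvector and that no other matrix does.\<close>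

lemma mat_fun_imat:
  fixes K :: "real^'n::finite^'n" and f :: "complex \<Rightarrow> complex"
  assumes skew: "transpose K = - K" and even: "\<And>z. f (- z) = f z"
    and basis: "skew_eigenbasis (\<lambda>x. K *v x) B l"
  shows "mat_fun f (imat K) = (\<chi> i j. \<Sum>e\<in>B. f (of_real (l e)) * of_real (e $ i * e $ j))"
    (is "_ = ?M")
  unfolding mat_fun_def
proof (rule the_equality)
  note eig = skew_eigenbasisD(4)[OF basis] and nrm = skew_eigenbasisD(5)[OF basis]
    and expand = skew_eigenbasisD(6)[OF basis]
  have Mv: "(?M *v v) $ i = (\<Sum>e\<in>B. f (of_real (l e)) * cdot e v * of_real (e $ i))" for v i
  proof -
    have "(?M *v v) $ i
        = (\<Sum>j\<in>UNIV. \<Sum>e\<in>B. f (of_real (l e)) * of_real (e $ i * e $ j) * v $ j)"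
      by (simp add: matrix_vector_mult_def sum_distrib_right)
    also have "\<dots> = (\<Sum>e\<in>B. \<Sum>j\<in>UNIV. f (of_real (l e)) * of_real (e $ i * e $ j) * v $ j)"
      by (rule sum.swap)
    also have "\<dots> = (\<Sum>e\<in>B. f (of_real (l e)) * cdot e v * of_real (e $ i))"
      by (simp add: cdot_def sum_distrib_left sum_distrib_right mult_ac)
    finally show ?thesis .
  qed
  show "\<forall>v \<mu>. imat K *v v = \<mu> *s v \<longrightarrow> ?M *v v = f \<mu> *s v"
  proof (intro allI impI)
    fix v \<mu> assume v: "imat K *v v = \<mu> *s v"
    have "f (of_real (l e)) * cdot e v = f \<mu> * cdot e v" if e: "e \<in> B" for e
    proof -
      \<comment> \<open>Applying \<open>imat K\<close> twice gives minus the square of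
        \<open>K\<close>, which has \<open>e\<close> as eigenvector; so \<open>v\<close> can have a
        component along \<open>e\<close> only if \<mu> is plus or minus \<open>l e\<close>.\<close>
      have "\<mu> * (\<mu> * cdot e v) = cdot e (\<mu> *s (\<mu> *s v))" by (simp only: cdot_cmul)
      also have "\<dots> = cdot e (imat K *v (imat K *v v))"
        by (simp add: v vector_scalar_commute)
      also have "\<dots> = - cdot (K *v (K *v e)) v"
        by (simp add: cdot_imat[OF skew])
      also have "\<dots> = (of_real (l e))\<^sup>2 * cdot e v"
        unfolding eig[OF e] cdot_scaleR by simp
      finally have "(\<mu>\<^sup>2 - (of_real (l e))\<^sup>2) * cdot e v = 0"
        by (simp add: power2_eq_square algebra_simps)
      then have "cdot e v = 0 \<or> \<mu> = of_real (l e) \<or> \<mu> = - of_real (l e)"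
        by (auto simp: power2_eq_iff)
      then show ?thesis using even by auto
    qed
    then have "(?M *v v) $ i = (\<Sum>e\<in>B. f \<mu> * (cdot e v * of_real (e $ i)))" for i
      unfolding Mv by (intro sum.cong) (auto simp: mult.assoc)
    then show "?M *v v = f \<mu> *s v"
      by (simp add: vec_eq_iff cdot_expand[OF expand] flip: sum_distrib_left)
  qed
  fix N :: "complex^'n^'n"
  assume N: "\<forall>v \<mu>. imat K *v v = \<mu> *s v \<longrightarrow> N *v v = f \<mu> *s v"
  have Ne: "N *v cvec e = f (of_real (l e)) *s cvec e" if e: "e \<in> B" for e
  proof (cases "l e = 0")
    case True
    then have "K *v e = 0" using nrm[OF e] by simp
    then have "imat K *v cvec e = 0 *s cvec e"
      by (simp add: imat_cvec) (simp add: cvec_def vec_eq_iff)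
    then show ?thesis using N True by auto
  next
    case False
    have KK: "imat K *v cvec (K *v e) = - (\<i> * (of_real (l e))\<^sup>2) *s cvec e"
      unfolding imat_cvec eig[OF e] by (simp add: cvec_def vec_eq_iff)
    \<comment> \<open>For c = 1 and c = -1 these are eigenvectors with eigenvalues
      \<open>l e\<close> and \<open>- l e\<close>. The hypothesis on \<open>N\<close> applies to
      both, and half their sum is \<open>cvec e\<close>.\<close>
    let ?v = "\<lambda>c. cvec e + (\<i> * c / of_real (l e)) *s cvec (K *v e)"
    have "imat K *v ?v c = (c * of_real (l e)) *s ?v c" if c: "c * c = 1" for c
    proof -
      have 1: "\<i> * c / of_real (l e) * - (\<i> * (of_real (l e))\<^sup>2) = c * of_real (l e)"
        using False by (simp add: power2_eq_square field_simps)
      have "c * of_real (l e) * (\<i> * c / of_real (l e)) = \<i> * (c * c)"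
        using False by simp
      then have 2: "c * of_real (l e) * (\<i> * c / of_real (l e)) = \<i>" using c by simp
      have "imat K *v ?v c = \<i> *s cvec (K *v e) + (c * of_real (l e)) *s cvec e"
        by (simp only: matrix_vector_right_distrib vector_scalar_commute KK imat_cvec[of K e]
            vector_smult_assoc 1)
      also have "\<dots> = (c * of_real (l e)) *s ?v c"
        by (simp only: vector_add_ldistrib vector_smult_assoc 2 add.commute)
      finally show ?thesis .
    qed
    then have "N *v ?v c = f (c * of_real (l e)) *s ?v c" if "c * c = 1" for c
      using N that by blast
    then have p: "N *v ?v 1 = f (of_real (l e)) *s ?v 1"
      and m: "N *v ?v (-1) = f (of_real (l e)) *s ?v (-1)"
      by (metis mult_1, metis even mult_minus1 mult_minus1_right minus_minus)
    have "N *v (?v 1 + ?v (-1)) = f (of_real (l e)) *s (?v 1 + ?v (-1))"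
      unfolding matrix_vector_right_distrib[of N "?v 1" "?v (-1)"] p m
      by (simp only: vector_add_ldistrib)
    moreover have "?v 1 + ?v (-1) = 2 *s cvec e" by (simp add: vec_eq_iff)
    ultimately have "2 *s (N *v cvec e) = 2 *s (f (of_real (l e)) *s cvec e)"
      by (simp only: vector_scalar_commute vector_smult_assoc mult.commute)
    then show ?thesis by (simp add: vec_eq_iff)
  qed
  have "N $ i $ k = ?M $ i $ k" for i k
  proof -
    have "N $ i $ k = (\<Sum>j\<in>UNIV. N $ i $ j * of_real (\<Sum>e\<in>B. e $ j * e $ k))"
      by (simp add: orthonormal_basis_kernel[OF expand] if_distrib sum.delta cong: if_cong)
    also have "\<dots> = (\<Sum>j\<in>UNIV. \<Sum>e\<in>B. N $ i $ j * of_real (e $ j) * of_real (e $ k))"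
      by (simp add: sum_distrib_left mult_ac)
    also have "\<dots> = (\<Sum>e\<in>B. \<Sum>j\<in>UNIV. N $ i $ j * of_real (e $ j) * of_real (e $ k))"
      by (rule sum.swap)
    also have "\<dots> = (\<Sum>e\<in>B. (N *v cvec e) $ i * of_real (e $ k))"
      by (simp add: matrix_vector_mult_def cvec_def sum_distrib_right)
    also have "\<dots> = ?M $ i $ k"
      by (simp add: Ne) (simp add: cvec_def mult_ac)
    finally show ?thesis .
  qed
  then show "N = ?M" by (simp add: vec_eq_iff)
qed

definition skewmat :: "('m::finite \<Rightarrow> real^'q^'q) \<Rightarrow> real^'m \<Rightarrow> real^'q^'q" where
  "skewmat U \<tau> = (\<Sum>j\<in>UNIV. \<tau> $ j *\<^sub>R U j)"

lemma Umat_eq_imat: "Umat U \<tau> = imat (skewmat U \<tau>)"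
  by (simp add: Umat_def imat_def skewmat_def vec_eq_iff)

lemma phi_eigenbasis:
  fixes U :: "'m::finite \<Rightarrow> real^'q::finite^'q"
  assumes "transpose (skewmat U \<tau>) = - skewmat U \<tau>"
    and "skew_eigenbasis (\<lambda>x. skewmat U \<tau> *v x) B l"
  shows "phi U (x, t) \<tau> = (\<Sum>e\<in>B. real_zcot (l e) * (x \<bullet> e)\<^sup>2) + 4 * (t \<bullet> \<tau>)"
proof -
  let ?Z = "\<lambda>i j. \<Sum>e\<in>B. real_zcot (l e) * (e $ i * e $ j)"
  have Zx: "(\<Sum>j\<in>UNIV. ?Z i j * x $ j)
      = (\<Sum>e\<in>B. real_zcot (l e) * e $ i * (x \<bullet> e))" for i
  proof -
    have "(\<Sum>j\<in>UNIV. ?Z i j * x $ j)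
      = (\<Sum>j\<in>UNIV. \<Sum>e\<in>B. real_zcot (l e) * e $ i * (x $ j * e $ j))"
      by (intro sum.cong refl) (simp add: sum_distrib_left sum_distrib_right mult_ac)
    also have "\<dots> = (\<Sum>e\<in>B. \<Sum>j\<in>UNIV. real_zcot (l e) * e $ i * (x $ j * e $ j))"
      by (rule sum.swap)
    finally show ?thesis by (simp add: inner_vec_def flip: sum_distrib_left)
  qed
  have "mat_fun zcot (Umat U \<tau>) = (\<chi> i j. of_real (?Z i j))"
    unfolding Umat_eq_imat
    by (subst mat_fun_imat[where B = B and l = l])
      (use assms in \<open>auto simp: zcot_minus zcot_of_real vec_eq_iff\<close>)
  then have "(mat_fun zcot (Umat U \<tau>) *v (\<chi> k. complex_of_real (x $ k))) $ i
      * cnj (complex_of_real (x $ i)) = of_real ((\<Sum>j\<in>UNIV. ?Z i j * x $ j) * x $ i)" for i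
    by (simp add: matrix_vector_mult_def)
  then have "phi U (x, t) \<tau> = (\<Sum>i\<in>UNIV. (\<Sum>j\<in>UNIV. ?Z i j * x $ j) * x $ i) + 4 * (t \<bullet> \<tau>)"
    by (simp only: phi_def fst_conv snd_conv Re_sum Re_complex_of_real)
  also have "(\<Sum>i\<in>UNIV. (\<Sum>j\<in>UNIV. ?Z i j * x $ j) * x $ i)
      = (\<Sum>i\<in>UNIV. (\<Sum>e\<in>B. real_zcot (l e) * e $ i * (x \<bullet> e)) * x $ i)"
    by (simp only: Zx)
  also have "\<dots> = (\<Sum>i\<in>UNIV. \<Sum>e\<in>B. real_zcot (l e) * (x \<bullet> e) * (x $ i * e $ i))"
    by (intro sum.cong refl) (simp add: sum_distrib_left sum_distrib_right mult_ac)
  also have "\<dots> = (\<Sum>e\<in>B. \<Sum>i\<in>UNIV. real_zcot (l e) * (x \<bullet> e) * (x $ i * e $ i))"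
    by (rule sum.swap)
  also have "\<dots> = (\<Sum>e\<in>B. real_zcot (l e) * (x \<bullet> e)\<^sup>2)"
    by (intro sum.cong refl)
      (simp add: inner_vec_def[of x] power2_eq_square mult.assoc flip: sum_distrib_left)
  finally show ?thesis .
qed

section \<open>Absolutely continuous curves\<close>

text \<open>The definition numbers its intervals; here any finite index set is allowed, so that the
  tagged cells of a division can serve as indices.\<close>

lemma abs_cont_onD_finite:
  fixes F :: "real \<Rightarrow> 'a::real_normed_vector"
  assumes "abs_cont_on a b F" "0 < \<epsilon>"
  shows "\<exists>\<delta>>0. \<forall>P. finite P \<longrightarrow> (\<forall>i\<in>P. a \<le> u i \<and> u i \<le> v i \<and> v i \<le> b) \<longrightarrow>
      (\<forall>i\<in>P. \<forall>j\<in>P. i \<noteq> j \<longrightarrow> v i \<le> u j \<or> v j \<le> u i) \<longrightarrow> (\<Sum>i\<in>P. v i - u i) < \<delta>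
      \<longrightarrow> (\<Sum>i\<in>P. norm (F (v i) - F (u i))) < \<epsilon>"
proof -
  obtain \<delta> where "\<delta> > 0" and \<delta>: "\<forall>(n::nat) l r. (\<forall>k<n. a \<le> l k \<and> l k \<le> r k \<and> r k \<le> b) \<and>
      (\<forall>i<n. \<forall>j<n. i \<noteq> j \<longrightarrow> r i \<le> l j \<or> r j \<le> l i) \<and> (\<Sum>k<n. r k - l k) < \<delta>
      \<longrightarrow> (\<Sum>k<n. norm (F (r k) - F (l k))) < \<epsilon>"
    using assms(1)[unfolded abs_cont_on_def, rule_format, OF assms(2)] by (elim exE conjE) (rule that)
  show ?thesis
  proof (intro exI[of _ \<delta>] conjI allI impI \<open>\<delta> > 0\<close>)
    fix P
    assume P: "finite P" and in_ab: "\<forall>i\<in>P. a \<le> u i \<and> u i \<le> v i \<and> v i \<le> b"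
      and disj: "\<forall>i\<in>P. \<forall>j\<in>P. i \<noteq> j \<longrightarrow> v i \<le> u j \<or> v j \<le> u i"
      and len: "(\<Sum>i\<in>P. v i - u i) < \<delta>"
    obtain f where f: "bij_betw f {..<card P} P"
      using ex_bij_betw_nat_finite[OF P] by (auto simp: atLeast0LessThan)
    have fP: "f i \<in> P" if "i < card P" for i using f that by (auto simp: bij_betw_def)
    have finj: "f i \<noteq> f j" if "i < card P" "j < card P" "i \<noteq> j" for i j
      using f that by (auto simp: bij_betw_def inj_on_def)
    have "(\<Sum>k<card P. norm (F (v (f k)) - F (u (f k)))) < \<epsilon>"
    proof (rule \<delta>[rule_format], intro conjI)
      show "(\<Sum>k<card P. v (f k) - u (f k)) < \<delta>"
        using len sum.reindex_bij_betw[OF f, of "\<lambda>i. v i - u i"] by simp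
      show "\<forall>k<card P. a \<le> u (f k) \<and> u (f k) \<le> v (f k) \<and> v (f k) \<le> b"
        using in_ab fP by blast
      show "\<forall>i<card P. \<forall>j<card P. i \<noteq> j \<longrightarrow> v (f i) \<le> u (f j) \<or> v (f j) \<le> u (f i)"
        using disj fP finj by simp
    qed
    then show "(\<Sum>i\<in>P. norm (F (v i) - F (u i))) < \<epsilon>"
      using sum.reindex_bij_betw[OF f, of "\<lambda>i. norm (F (v i) - F (u i))"] by simp
  qed
qed

text \<open>Straddle estimate: with \<open>x\<close> between \<open>u\<close> and \<open>v\<close>
  the two one-sided errors add up to at most \<open>e * (v - u)\<close>.\<close>

lemma vector_derivative_straddle:
  fixes F :: "real \<Rightarrow> 'a::real_normed_vector"
  assumes "(F has_vector_derivative D) (at x)" "0 < e"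
  obtains d where "0 < d"
    "\<And>u v. \<lbrakk>u \<le> x; x \<le> v; x - d < u; v < x + d\<rbrakk> \<Longrightarrow> norm (F v - F u) \<le> (v - u) * (norm D + e)"
proof -
  obtain d where "d > 0"
    and d: "\<And>y. norm (y - x) < d \<Longrightarrow> norm (F y - F x - (y - x) *\<^sub>R D) \<le> e * norm (y - x)"
    using assms unfolding has_vector_derivative_def has_derivative_at_alt by blast
  show ?thesis
  proof (rule that[OF \<open>d > 0\<close>])
    fix u v assume uv: "u \<le> x" "x \<le> v" "x - d < u" "v < x + d"
    have "F v - F u = (F v - F x - (v - x) *\<^sub>R D) - (F u - F x - (u - x) *\<^sub>R D) + (v - u) *\<^sub>R D"
      by (simp add: algebra_simps)
    then have "norm (F v - F u) \<le> norm (F v - F x - (v - x) *\<^sub>R D)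
        + norm (F u - F x - (u - x) *\<^sub>R D) + norm ((v - u) *\<^sub>R D)"
      by (simp only:) (rule order_trans[OF norm_triangle_ineq add_right_mono[OF norm_triangle_ineq4]])
    also have "\<dots> \<le> e * (v - x) + e * (x - u) + (v - u) * norm D"
      using d[of v] d[of u] uv by (intro add_mono) auto
    also have "\<dots> = (v - u) * (norm D + e)" by (simp add: algebra_simps)
    finally show "norm (F v - F u) \<le> (v - u) * (norm D + e)" .
  qed
qed

text \<open>The fundamental theorem of calculus as an inequality, by a gauge argument. Cells tagged
  at a point of differentiability are handled by the straddle estimate and sum to a Riemann sum of
  \<open>h\<close>; cells tagged in the exceptional null set have small total length, so absolute
  continuity makes their total increment small.\<close>

lemma abs_cont_on_norm_bound:
  fixes F :: "real \<Rightarrow> 'a::real_normed_vector"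
  assumes ac: "abs_cont_on a b F" and lr: "a \<le> l" "l \<le> r" "r \<le> b"
    and ae: "AE s in lebesgue. s \<in> {l..r} \<longrightarrow> (\<exists>D. (F has_vector_derivative D) (at s) \<and> norm D \<le> h s)"
    and h: "h integrable_on {l..r}"
  shows "norm (F r - F l) \<le> integral {l..r} h"
proof (rule field_le_epsilon)
  fix e0 :: real assume "e0 > 0"
  define \<epsilon> where "\<epsilon> = e0 / 3"
  have \<epsilon>: "\<epsilon> > 0" using \<open>e0 > 0\<close> by (simp add: \<epsilon>_def)
  define e where "e = \<epsilon> / (r - l + 1)"
  have e: "e > 0" using \<epsilon> lr by (simp add: e_def)
  obtain N where N: "N \<in> null_sets lebesgue"
    and sub: "{s. \<not> (s \<in> {l..r} \<longrightarrow> (\<exists>D. (F has_vector_derivative D) (at s) \<and> norm D \<le> h s))} \<subseteq> N"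
    using ae unfolding eventually_ae_filter by auto
  have good: "\<exists>D. (F has_vector_derivative D) (at s) \<and> norm D \<le> h s"
    if "s \<in> {l..r}" "s \<notin> N" for s
    using sub that by blast
  \<comment> \<open>On \<open>N\<close> nothing is known about the sign of \<open>h\<close>. Setting
    it to 0 there keeps the integral and makes the terms that complete the sum over \<open>G\<close>
    to a full Riemann sum nonnegative.\<close>
  define h0 where "h0 s = (if s \<in> N then 0 else h s)" for s
  have "(h has_integral integral {l..r} h) {l..r}" using h by blast
  then have h0: "(h0 has_integral integral {l..r} h) {l..r}"
    by (rule has_integral_spike[rotated 2, where S = N])
      (use N in \<open>auto simp: h0_def negligible_iff_null_sets\<close>)
  then obtain g1 where g1: "gauge g1"
    and R: "\<And>p. \<lbrakk>p tagged_division_of {l..r}; g1 fine p\<rbrakk>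
      \<Longrightarrow> norm ((\<Sum>(x, K)\<in>p. measure lborel K *\<^sub>R h0 x) - integral {l..r} h) < \<epsilon>"
    using \<epsilon> unfolding has_integral_real by meson
  obtain \<delta> where \<delta>: "0 < \<delta>"
    "\<And>P. finite P \<Longrightarrow> \<forall>i\<in>P. a \<le> Inf (snd i) \<and> Inf (snd i) \<le> Sup (snd i) \<and> Sup (snd i) \<le> b \<Longrightarrow>
        \<forall>i\<in>P. \<forall>j\<in>P. i \<noteq> j \<longrightarrow> Sup (snd i) \<le> Inf (snd j) \<or> Sup (snd j) \<le> Inf (snd i) \<Longrightarrow>
        (\<Sum>i\<in>P. Sup (snd i) - Inf (snd i)) < \<delta>
      \<Longrightarrow> (\<Sum>i\<in>P. norm (F (Sup (snd i)) - F (Inf (snd (i :: real \<times> real set))))) < \<epsilon>"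
    using abs_cont_onD_finite[OF ac \<epsilon>, of "\<lambda>i. Inf (snd i)" "\<lambda>i. Sup (snd i)"] by blast
  \<comment> \<open>The gauge \<open>g2\<close> below confines every cell tagged in \<open>N\<close>
    to this open set, so these cells have total length below \<delta>.\<close>
  obtain T where T: "open T" "N \<subseteq> T" "T \<in> lmeasurable" "measure lebesgue T < \<delta>"
  proof -
    obtain T where T: "open T" "N \<subseteq> T" "(T - N) \<in> lmeasurable" "emeasure lebesgue (T - N) < ennreal \<delta>"
      using sets_lebesgue_outer_open[of N \<delta>] N \<delta>(1) by (auto simp: null_sets_def)
    have "emeasure lebesgue T = emeasure lebesgue (T - N)"
      using N T(1) by (simp add: emeasure_Diff_null_set)
    then have "emeasure lebesgue T < ennreal \<delta>" using T(4) by simp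
    moreover have Tm: "T \<in> lmeasurable"
      using T(1) calculation by (intro fmeasurableI) (auto intro: less_trans simp: ennreal_less_top)
    ultimately have "measure lebesgue T < \<delta>"
      by (simp add: emeasure_eq_measure2 ennreal_less_iff)
    note this Tm
    then show ?thesis using that T by blast
  qed
  have "\<exists>d>0. x \<in> {l..r} \<longrightarrow> x \<notin> N \<longrightarrow> (\<forall>u v. u \<le> x \<longrightarrow> x \<le> v \<longrightarrow> x - d < u \<longrightarrow> v < x + d \<longrightarrow>
      norm (F v - F u) \<le> (v - u) * (h x + e))" for x
  proof (cases "x \<in> {l..r} \<and> x \<notin> N")
    case True
    then obtain D where D: "(F has_vector_derivative D) (at x)" "norm D \<le> h x" using good by blast
    obtain d where "d > 0" and d: "\<And>u v. \<lbrakk>u \<le> x; x \<le> v; x - d < u; v < x + d\<rbrakk> \<Longrightarrow>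
        norm (F v - F u) \<le> (v - u) * (norm D + e)"
      using vector_derivative_straddle[OF D(1) e] by blast
    have "norm (F v - F u) \<le> (v - u) * (h x + e)" if "u \<le> x" "x \<le> v" "x - d < u" "v < x + d" for u v
      by (rule order_trans[OF d[OF that]]) (use that D(2) in \<open>auto intro!: mult_left_mono\<close>)
    then show ?thesis using \<open>d > 0\<close> by blast
  qed (auto intro: exI[of _ 1])
  then obtain d where d: "\<And>x. d x > 0"
    and straddle: "\<And>x u v. \<lbrakk>x \<in> {l..r}; x \<notin> N; u \<le> x; x \<le> v; x - d x < u; v < x + d x\<rbrakk>
      \<Longrightarrow> norm (F v - F u) \<le> (v - u) * (h x + e)" by metis
  define g2 where "g2 x = (if x \<in> N then T else ball x (d x))" for x
  have g2: "gauge g2" using T(1,2) d by (auto simp: gauge_def g2_def)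
  obtain p where p: "p tagged_division_of {l..r}" and "(\<lambda>x. g1 x \<inter> g2 x) fine p"
    using fine_division_exists_real[OF gauge_Int[OF g1 g2]] by blast
  then have fine1: "g1 fine p" and fine2: "g2 fine p" by (auto simp: fine_Int)
  have fin: "finite p" using p by blast
  have K: "K = {Inf K..Sup K}" "l \<le> Inf K" "Inf K \<le> x" "x \<le> Sup K" "Sup K \<le> r" "x \<in> {l..r}"
    "measure lborel K = Sup K - Inf K" "K \<in> lmeasurable" "measure lebesgue K = Sup K - Inf K" if xK: "(x, K) \<in> p" for x K
  proof -
    obtain u v where uv: "K = {u..v}" using tagged_division_ofD(4)[OF p xK] by (auto simp: box_real)
    have "x \<in> K" "K \<subseteq> {l..r}" using tagged_division_ofD(2,3)[OF p xK] by auto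
    then show "K = {Inf K..Sup K}" "l \<le> Inf K" "Inf K \<le> x" "x \<le> Sup K" "Sup K \<le> r" "x \<in> {l..r}"
      "measure lborel K = Sup K - Inf K" "K \<in> lmeasurable" "measure lebesgue K = Sup K - Inf K"
      using lmeasurable_cbox[of u v] by (auto simp: uv measure_completion)
  qed
  let ?len = "\<lambda>i. Sup (snd i) - Inf (snd i) :: real"
  let ?dF = "\<lambda>i. norm (F (Sup (snd i)) - F (Inf (snd i)))"
  \<comment> \<open>Degenerate cells are left out: they contribute no increment, and disjoint
    interiors imply the separation \<open>sep\<close> only for cells of positive length.\<close>
  define Q where "Q = {i \<in> p. fst i \<in> N \<and> Inf (snd i) < Sup (snd i)}"
  define G where "G = {i \<in> p. fst i \<notin> N}"
  have finQ: "finite Q" and finG: "finite G" using fin by (auto simp: Q_def G_def)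
  have sep: "Sup K \<le> Inf K' \<or> Sup K' \<le> Inf K"
    if "(x, K) \<in> Q" "(x', K') \<in> Q" "(x, K) \<noteq> (x', K')" for x K x' K'
  proof (rule ccontr)
    assume nle: "\<not> ?thesis"
    have pp: "(x, K) \<in> p" "(x', K') \<in> p" and ne: "Inf K < Sup K" "Inf K' < Sup K'"
      using that by (auto simp: Q_def)
    have "interior K \<inter> interior K' = {}" using tagged_division_ofD(5)[OF p pp(1,2) that(3)] .
    moreover have "interior K = {Inf K<..<Sup K}" "interior K' = {Inf K'<..<Sup K'}"
      using K(1)[OF pp(1)] K(1)[OF pp(2)] by (metis interior_atLeastAtMost_real)+
    ultimately have "{max (Inf K) (Inf K')<..<min (Sup K) (Sup K')} = {}" by auto
    then show False using nle ne
      by (subst (asm) greaterThanLessThan_empty_iff) auto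
  qed
  have "(\<Sum>i\<in>Q. ?len i) = (\<Sum>i\<in>Q. measure lebesgue (snd i))"
    by (intro sum.cong refl) (auto simp: Q_def K)
  also have "\<dots> = measure lebesgue (\<Union>(snd ` Q))"
  proof (rule measure_negligible_finite_Union_image[symmetric, OF finQ])
    show "snd i \<in> lmeasurable" if "i \<in> Q" for i
      using that K(8)[of "fst i" "snd i"] by (simp add: Q_def)
    show "pairwise (\<lambda>i j. negligible (snd i \<inter> snd j)) Q"
    proof (rule pairwiseI)
      fix i j assume ij: "i \<in> Q" "j \<in> Q" "i \<noteq> j"
      have "snd i = {Inf (snd i)..Sup (snd i)}" "snd j = {Inf (snd j)..Sup (snd j)}"
        using K(1)[of "fst i" "snd i"] K(1)[of "fst j" "snd j"] ij by (auto simp: Q_def)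
      moreover have "Sup (snd i) \<le> Inf (snd j) \<or> Sup (snd j) \<le> Inf (snd i)"
        using sep[of "fst i" "snd i" "fst j" "snd j"] ij by simp
      ultimately have "snd i \<inter> snd j \<subseteq> {Sup (snd i), Sup (snd j)}"
        by (smt (verit) IntE atLeastAtMost_iff insertCI subsetI)
      then show "negligible (snd i \<inter> snd j)"
        by (meson finite.emptyI finite.insertI negligible_finite negligible_subset)
    qed
  qed
  also have "\<dots> \<le> measure lebesgue T"
  proof (rule measure_mono_fmeasurable[OF _ _ T(3)])
    show "\<Union>(snd ` Q) \<subseteq> T"
      using fine2 by (force simp: fine_def g2_def Q_def)
    show "\<Union>(snd ` Q) \<in> sets lebesgue"
      using finQ K(8) by (intro sets.finite_Union) (auto simp: Q_def)
  qed
  also have "\<dots> < \<delta>" by (rule T(4))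
  finally have lenQ: "(\<Sum>i\<in>Q. ?len i) < \<delta>" .
  have Qlt: "(\<Sum>i\<in>Q. ?dF i) < \<epsilon>"
  proof (rule \<delta>(2)[OF finQ _ _ lenQ])
    show "\<forall>i\<in>Q. a \<le> Inf (snd i) \<and> Inf (snd i) \<le> Sup (snd i) \<and> Sup (snd i) \<le> b"
    proof
      fix i assume "i \<in> Q"
      then show "a \<le> Inf (snd i) \<and> Inf (snd i) \<le> Sup (snd i) \<and> Sup (snd i) \<le> b"
        using K[of "fst i" "snd i"] lr by (auto simp: Q_def)
    qed
    show "\<forall>i\<in>Q. \<forall>j\<in>Q. i \<noteq> j \<longrightarrow> Sup (snd i) \<le> Inf (snd j) \<or> Sup (snd j) \<le> Inf (snd i)"
      using sep by (metis prod.collapse)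
  qed
  have dFG: "?dF i \<le> ?len i * (h0 (fst i) + e)" if i: "i \<in> G" for i
  proof -
    obtain x K where xK: "i = (x, K)" by (cases i)
    then have xKp: "(x, K) \<in> p" and xN: "x \<notin> N" using i by (auto simp: G_def)
    have "K \<subseteq> ball x (d x)" using fineD[OF fine2 xKp] xN by (simp add: g2_def)
    moreover have "Inf K \<in> K" "Sup K \<in> K"
      using K(1,3,4)[OF xKp] by (metis atLeastAtMost_iff order_trans order_refl)+
    ultimately have "x - d x < Inf K" "Sup K < x + d x" by (auto simp: dist_real_def subset_iff)
    from straddle[OF K(6)[OF xKp] xN K(3,4)[OF xKp] this] show ?thesis
      using xN by (simp add: xK h0_def)
  qed
  have "norm (F r - F l) = norm (\<Sum>i\<in>p. F (Sup (snd i)) - F (Inf (snd i)))"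
    using additive_tagged_division_1[OF lr(2) p, of F] by (simp add: case_prod_unfold)
  also have "\<dots> \<le> (\<Sum>i\<in>p. ?dF i)" by (rule norm_sum)
  also have "\<dots> = (\<Sum>i\<in>Q \<union> G. ?dF i)"
  proof (rule sum.mono_neutral_right[OF fin])
    show "\<forall>i\<in>p - (Q \<union> G). ?dF i = 0"
    proof
      fix i assume i: "i \<in> p - (Q \<union> G)"
      then have "Inf (snd i) = Sup (snd i)" using K(3,4)[of "fst i" "snd i"] by (auto simp: Q_def G_def)
      then show "?dF i = 0" by simp
    qed
  qed (auto simp: Q_def G_def)
  also have "\<dots> = (\<Sum>i\<in>Q. ?dF i) + (\<Sum>i\<in>G. ?dF i)"
    by (rule sum.union_disjoint[OF finQ finG]) (auto simp: Q_def G_def)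
  also have "\<dots> \<le> \<epsilon> + (\<Sum>i\<in>G. ?len i * (h0 (fst i) + e))"
    using Qlt dFG by (intro add_mono sum_mono) auto
  also have "(\<Sum>i\<in>G. ?len i * (h0 (fst i) + e)) \<le> (\<Sum>i\<in>p. ?len i * (h0 (fst i) + e))"
  proof (rule sum_mono2[OF fin])
    show "0 \<le> ?len i * (h0 (fst i) + e)" if "i \<in> p - G" for i
      using that e K(3,4)[of "fst i" "snd i"] by (auto simp: G_def h0_def)
  qed (auto simp: G_def)
  also have "(\<Sum>i\<in>p. ?len i * (h0 (fst i) + e))
      = (\<Sum>i\<in>p. ?len i * h0 (fst i)) + (\<Sum>i\<in>p. ?len i) * e"
    by (simp add: distrib_left sum.distrib sum_distrib_right)
  also have "(\<Sum>i\<in>p. ?len i) = r - l"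
    using additive_tagged_division_1[OF lr(2) p, of "\<lambda>x. x"] by (simp add: case_prod_unfold)
  also have "(\<Sum>i\<in>p. ?len i * h0 (fst i)) = (\<Sum>(x, K)\<in>p. measure lborel K *\<^sub>R h0 x)"
    by (intro sum.cong refl) (auto simp: K)
  also have "\<dots> \<le> integral {l..r} h + \<epsilon>" using R[OF p fine1] by (simp add: real_norm_def)
  also have "(r - l) * e \<le> \<epsilon>" using lr \<epsilon> by (simp add: e_def field_simps)
  finally show "norm (F r - F l) \<le> integral {l..r} h + e0" by (simp add: \<epsilon>_def)
qed

section \<open>Extremals\<close>

text \<open>Integrated Euler--Lagrange equation of \<open>\<integral> (\<bar>x'\<bar>\<^sup>2 - 2 \<langle>A x, x'\<rangle>)\<close>; \<open>w\<close> is the initial velocity.\<close>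

definition extremal :: "('a::real_normed_vector \<Rightarrow> 'a) \<Rightarrow> 'a \<Rightarrow> (real \<Rightarrow> 'a) \<Rightarrow> bool" where
  "extremal A w \<xi> \<longleftrightarrow> \<xi> 0 = 0 \<and> (\<forall>s. (\<xi> has_vector_derivative (w + 2 *\<^sub>R A (\<xi> s))) (at s))"

lemma extremal_sum:
  assumes "linear A" "\<And>i. i \<in> I \<Longrightarrow> extremal A (w i) (\<xi> i)"
  shows "extremal A (\<Sum>i\<in>I. c i *\<^sub>R w i) (\<lambda>s. \<Sum>i\<in>I. c i *\<^sub>R \<xi> i s)"
  using assms unfolding extremal_def
  by (auto intro!: derivative_eq_intros
      simp: linear_sum linear_scale scaleR_sum_right scaleR_add_right sum.distrib mult.commute)

lemma extremal_add:
  assumes "linear A" "extremal A w \<xi>" "extremal A w' \<xi>'"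
  shows "extremal A (w + w') (\<lambda>s. \<xi> s + \<xi>' s)"
  using assms unfolding extremal_def
  by (auto intro!: derivative_eq_intros simp: linear_add scaleR_add_right)

lemma extremal_scaleR:
  assumes "linear A" "extremal A w \<xi>"
  shows "extremal A (c *\<^sub>R w) (\<lambda>s. c *\<^sub>R \<xi> s)"
  using extremal_sum[of A "{()}" "\<lambda>_. w" "\<lambda>_. \<xi>" "\<lambda>_. c"] assms by simp

text \<open>The span of \<open>e\<close> and \<open>A e\<close> is invariant under \<open>A\<close>,
  so the equation for an extremal becomes a scalar system for the coefficients \<open>a\<close> and
  \<open>b\<close>; \<open>c\<close> and \<open>d\<close> are the coefficients of the initial
  velocity.\<close>

lemma extremal_eigen_plane:
  assumes "linear A" "A (A e) = - l\<^sup>2 *\<^sub>R e" "a 0 = 0" "b 0 = 0"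
    and "\<And>s. (a has_real_derivative c - 2 * l\<^sup>2 * b s) (at s)"
    and "\<And>s. (b has_real_derivative d + 2 * a s) (at s)"
  shows "extremal A (c *\<^sub>R e + d *\<^sub>R A e) (\<lambda>s. a s *\<^sub>R e + b s *\<^sub>R A e)"
  unfolding extremal_def
proof (intro conjI allI)
  show "a 0 *\<^sub>R e + b 0 *\<^sub>R A e = 0" by (simp add: assms)
  fix s
  have "((\<lambda>s. a s *\<^sub>R e + b s *\<^sub>R A e) has_vector_derivative
      (c - 2 * l\<^sup>2 * b s) *\<^sub>R e + (d + 2 * a s) *\<^sub>R A e) (at s)"
    using assms(5,6)[of s] by (auto intro!: derivative_eq_intros)
  also have "(c - 2 * l\<^sup>2 * b s) *\<^sub>R e + (d + 2 * a s) *\<^sub>R A e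
      = c *\<^sub>R e + d *\<^sub>R A e + 2 *\<^sub>R A (a s *\<^sub>R e + b s *\<^sub>R A e)"
    by (simp add: linear_add[OF assms(1)] linear_scale[OF assms(1)] assms(2) algebra_simps)
  finally show "((\<lambda>s. a s *\<^sub>R e + b s *\<^sub>R A e) has_vector_derivative
      c *\<^sub>R e + d *\<^sub>R A e + 2 *\<^sub>R A (a s *\<^sub>R e + b s *\<^sub>R A e)) (at s)" .
qed

lemma extremal_eigenvector:
  assumes "linear A" "A (A e) = - l\<^sup>2 *\<^sub>R e"
  shows "\<exists>\<xi>. extremal A e \<xi>"
proof (cases "l = 0")
  case True
  have "extremal A (1 *\<^sub>R e + 0 *\<^sub>R A e) (\<lambda>s. s *\<^sub>R e + s\<^sup>2 *\<^sub>R A e)"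
    by (rule extremal_eigen_plane[OF assms]) (auto simp: True intro!: derivative_eq_intros)
  then show ?thesis by auto
next
  case False
  have "extremal A (1 *\<^sub>R e + 0 *\<^sub>R A e)
      (\<lambda>s. (sin (2 * l * s) / (2 * l)) *\<^sub>R e + ((1 - cos (2 * l * s)) / (2 * l\<^sup>2)) *\<^sub>R A e)"
    by (rule extremal_eigen_plane[OF assms])
      (use False in \<open>auto intro!: derivative_eq_intros simp: field_simps power2_eq_square\<close>)
  then show ?thesis by auto
qed

text \<open>This is where the cotangent comes from: solving the endpoint condition for the initial
  velocity divides by \<open>sin l\<close>, nonzero for 0 < l < \<pi>. The part \<open>- A e\<close>
  will drop out of the product of the initial velocity with the endpoint, leaving the form in
  \<open>phi\<close>.\<close>

lemma extremal_to_eigenvector: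
  assumes "linear A" "A (A e) = - l\<^sup>2 *\<^sub>R e" "0 \<le> l" "l < pi"
  shows "\<exists>\<xi>. extremal A (real_zcot l *\<^sub>R e - A e) \<xi> \<and> \<xi> 1 = e"
proof (cases "l = 0")
  case True
  have "extremal A (1 *\<^sub>R e + (-1) *\<^sub>R A e) (\<lambda>s. s *\<^sub>R e + (s\<^sup>2 - s) *\<^sub>R A e)"
    by (rule extremal_eigen_plane[OF assms(1,2)]) (auto simp: True intro!: derivative_eq_intros)
  then show ?thesis
    by (intro exI[of _ "\<lambda>s. s *\<^sub>R e + (s\<^sup>2 - s) *\<^sub>R A e"]) (simp add: True real_zcot_def)
next
  case False
  let ?a = "\<lambda>s. (1 - cos (2 * l * s) + cot l * sin (2 * l * s)) / 2"
  let ?b = "\<lambda>s. (- sin (2 * l * s) + cot l * (1 - cos (2 * l * s))) / (2 * l)"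
  have sin: "sin l \<noteq> 0" using assms(3,4) False sin_gt_zero[of l] by simp
  have 1: "?a 1 = 1" and 2: "?b 1 = 0"
  proof -
    have "1 - cos (2 * l) + cot l * sin (2 * l) = 2 * ((sin l)\<^sup>2 + (cos l)\<^sup>2)"
      using sin by (simp add: cos_double_sin sin_double cot_def power2_eq_square)
    then show "?a 1 = 1" by simp
    show "?b 1 = 0"
      using sin by (simp add: cos_double_sin sin_double cot_def power2_eq_square)
  qed
  have "extremal A (real_zcot l *\<^sub>R e + (-1) *\<^sub>R A e) (\<lambda>s. ?a s *\<^sub>R e + ?b s *\<^sub>R A e)"
  proof (rule extremal_eigen_plane[OF assms(1,2)])
    fix s
    show "(?a has_real_derivative real_zcot l - 2 * l\<^sup>2 * ?b s) (at s)"
      using False by (auto intro!: derivative_eq_intros simp: real_zcot_def power2_eq_square field_simps)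
    show "(?b has_real_derivative -1 + 2 * ?a s) (at s)"
      using False by (auto intro!: derivative_eq_intros simp: field_simps)
  qed auto
  moreover have "?a 1 *\<^sub>R e + ?b 1 *\<^sub>R A e = e" unfolding 1 2 by simp
  ultimately show ?thesis
    by (intro exI[of _ "\<lambda>s. ?a s *\<^sub>R e + ?b s *\<^sub>R A e"]) simp
qed

lemma inner_has_real_derivative:
  fixes f g :: "real \<Rightarrow> 'a::real_inner"
  assumes "(f has_vector_derivative f') (at s)" "(g has_vector_derivative g') (at s)"
  shows "((\<lambda>s. f s \<bullet> g s) has_real_derivative f s \<bullet> g' + f' \<bullet> g s) (at s)"
  using bounded_bilinear.has_vector_derivative[OF bounded_bilinear_inner assms]
  by (simp add: has_real_derivative_iff_has_vector_derivative)

section \<open>Existence, stability and energy of the extremals of a skew map\<close>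

locale skew_map =
  fixes A :: "'a::euclidean_space \<Rightarrow> 'a"
  assumes lin: "linear A" and skew: "A x \<bullet> y = - (x \<bullet> A y)"
begin

lemma inner_self [simp]: "A x \<bullet> x = 0" "x \<bullet> A x = 0"
  using skew[of x x] by (auto simp: inner_commute)

lemma A_has_vector_derivative:
  assumes "(\<xi> has_vector_derivative v) (at s)"
  shows "((\<lambda>s. A (\<xi> s)) has_vector_derivative A v) (at s)"
  using bounded_linear.has_vector_derivative[OF linear_conv_bounded_linear[THEN iffD1, OF lin] assms] .

lemma extremal_exists: "\<exists>\<xi>. extremal A w \<xi>"
proof -
  obtain B l where basis: "skew_eigenbasis A B l" using skew_eigenbasis_exists[OF lin skew] by blast
  note eig = skew_eigenbasisD(4)[OF basis] and expand = skew_eigenbasisD(6)[OF basis]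
  have "\<forall>e\<in>B. \<exists>\<xi>. extremal A e \<xi>" using extremal_eigenvector[OF lin eig] by blast
  then obtain \<xi> where "\<And>e. e \<in> B \<Longrightarrow> extremal A e (\<xi> e)" by metis
  from extremal_sum[OF lin this, of B "\<lambda>e. e" "\<lambda>e. w \<bullet> e"] show ?thesis
    unfolding expand by blast
qed

lemma extremal_to_point:
  assumes basis: "skew_eigenbasis A B l" and l: "\<And>e. e \<in> B \<Longrightarrow> l e < pi"
  shows "\<exists>\<xi>. extremal A ((\<Sum>e\<in>B. (real_zcot (l e) * (x \<bullet> e)) *\<^sub>R e) - A x) \<xi> \<and> \<xi> 1 = x"
proof -
  note expand = skew_eigenbasisD(6)[OF basis]
  have "0 \<le> l e" if "e \<in> B" for e
    using skew_eigenbasisD(5)[OF basis that] norm_ge_zero[of "A e"] by simp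
  then have "\<forall>e\<in>B. \<exists>\<xi>. extremal A (real_zcot (l e) *\<^sub>R e - A e) \<xi> \<and> \<xi> 1 = e"
    using extremal_to_eigenvector[OF lin skew_eigenbasisD(4)[OF basis]] l by blast
  then obtain \<xi> where \<xi>: "\<And>e. e \<in> B \<Longrightarrow> extremal A (real_zcot (l e) *\<^sub>R e - A e) (\<xi> e)"
    and 1: "\<And>e. e \<in> B \<Longrightarrow> \<xi> e 1 = e" by metis
  let ?\<xi> = "\<lambda>s. \<Sum>e\<in>B. (x \<bullet> e) *\<^sub>R \<xi> e s"
  have "extremal A (\<Sum>e\<in>B. (x \<bullet> e) *\<^sub>R (real_zcot (l e) *\<^sub>R e - A e)) ?\<xi>"
    by (rule extremal_sum[OF lin \<xi>])
  also have "(\<Sum>e\<in>B. (x \<bullet> e) *\<^sub>R (real_zcot (l e) *\<^sub>R e - A e))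
      = (\<Sum>e\<in>B. (real_zcot (l e) * (x \<bullet> e)) *\<^sub>R e) - A (\<Sum>e\<in>B. (x \<bullet> e) *\<^sub>R e)"
    by (simp add: linear_sum[OF lin] linear_scale[OF lin] scaleR_diff_right sum_subtractf mult.commute)
  finally have "extremal A ((\<Sum>e\<in>B. (real_zcot (l e) * (x \<bullet> e)) *\<^sub>R e) - A x) ?\<xi>"
    unfolding expand .
  moreover have "?\<xi> 1 = x" using 1 expand[of x] by simp
  ultimately show ?thesis by blast
qed

text \<open>Skewness removes \<open>A\<close> from the derivative of \<open>\<bar>\<delta>\<bar>\<^sup>2\<close>, so no exponential factor appears.\<close>

lemma perturbation_bound:
  assumes \<delta>: "\<delta> 0 = 0" "\<And>s. (\<delta> has_vector_derivative (f s + 2 *\<^sub>R A (\<delta> s))) (at s)"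
    and f: "\<And>s. s \<in> {0..1} \<Longrightarrow> norm (f s) \<le> E" and s: "s \<in> {0..1}"
  shows "norm (\<delta> s) \<le> 2 * E"
proof -
  have cont: "continuous_on {0..1} \<delta>"
    using \<delta>(2) by (meson continuous_at_imp_continuous_on has_vector_derivative_continuous)
  \<comment> \<open>At the time \<open>m\<close> of largest norm, the mean value theorem bounds the
    square of \<open>norm (\<delta> m)\<close> by \<open>2 * norm (\<delta> m) * E\<close>; one
    factor cancels.\<close>
  obtain m where m: "m \<in> {0..1}" and max: "\<And>r. r \<in> {0..1} \<Longrightarrow> norm (\<delta> r) \<le> norm (\<delta> m)"
    using continuous_attains_sup[of "{0..1::real}" "\<lambda>r. norm (\<delta> r)"] continuous_on_norm[OF cont] by auto
  have der: "((\<lambda>s. \<delta> s \<bullet> \<delta> s) has_real_derivative 2 * (\<delta> r \<bullet> f r)) (at r)" for r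
    using inner_has_real_derivative[OF \<delta>(2)[of r] \<delta>(2)[of r]]
    by (simp add: inner_simps inner_commute)
  have "norm (\<delta> m) \<le> 2 * E"
  proof (cases "m = 0 \<or> \<delta> m = 0")
    case True
    then show ?thesis using \<delta>(1) f[of 0] by (smt (verit) norm_ge_zero norm_zero atLeastAtMost_iff)
  next
    case False
    then have "0 < m" using m by simp
    from MVT2[OF this, of "\<lambda>s. \<delta> s \<bullet> \<delta> s" "\<lambda>r. 2 * (\<delta> r \<bullet> f r)"] der
    obtain r where r: "0 < r" "r < m" "\<delta> m \<bullet> \<delta> m - \<delta> 0 \<bullet> \<delta> 0 = (m - 0) * (2 * (\<delta> r \<bullet> f r))" by blast
    have r01: "r \<in> {0..1}" using r m by auto
    have "\<delta> r \<bullet> f r \<le> norm (\<delta> m) * E"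
      by (rule order_trans[OF norm_cauchy_schwarz]) (intro mult_mono max f r01 norm_ge_zero)
    moreover have "0 \<le> norm (\<delta> m) * E"
      using f[OF m] by (meson mult_nonneg_nonneg norm_ge_zero order_trans)
    ultimately have "m * (2 * (\<delta> r \<bullet> f r)) \<le> 1 * (2 * (norm (\<delta> m) * E))"
      using m by (intro order_trans[OF mult_left_mono mult_right_mono]) auto
    then have "norm (\<delta> m) * norm (\<delta> m) \<le> norm (\<delta> m) * (2 * E)"
      using r(3) \<delta>(1) by (simp add: dot_square_norm power2_eq_square)
    then show ?thesis using False by simp
  qed
  then show ?thesis using max[OF s] by simp
qed

lemma extremal_norm_le: "extremal A w \<xi> \<Longrightarrow> s \<in> {0..1} \<Longrightarrow> norm (\<xi> s) \<le> 2 * norm w"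
  using perturbation_bound[of \<xi> "\<lambda>_. w" "norm w" s] by (auto simp: extremal_def)

text \<open>The difference of the two curves solves the equation for \<open>A\<close> with forcing
  \<open>w - w' + 2 *\<^sub>R (A (\<xi>' s) - A' (\<xi>' s))\<close>, so
  \<open>perturbation_bound\<close> applies. Uniqueness is the case \<open>K = 0\<close>, and
  continuity in the parameter and the initial velocity also follows from it.\<close>

lemma extremal_stability:
  assumes \<xi>: "extremal A w \<xi>" and \<xi>': "extremal A' w' \<xi>'" and "skew_map A'"
    and K: "\<And>x. norm (A x - A' x) \<le> K * norm x" and s: "s \<in> {0..1}"
  shows "norm (\<xi> s - \<xi>' s) \<le> 2 * (norm (w - w') + 4 * K * norm w')"
proof (rule perturbation_bound[OF _ _ _ s])
  let ?f = "\<lambda>s. w - w' + 2 *\<^sub>R (A (\<xi>' s) - A' (\<xi>' s))"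
  show "\<xi> 0 - \<xi>' 0 = 0" using \<xi> \<xi>' by (simp add: extremal_def)
  show "((\<lambda>s. \<xi> s - \<xi>' s) has_vector_derivative ?f s + 2 *\<^sub>R A (\<xi> s - \<xi>' s)) (at s)" for s
  proof -
    have "((\<lambda>s. \<xi> s - \<xi>' s) has_vector_derivative (w + 2 *\<^sub>R A (\<xi> s)) - (w' + 2 *\<^sub>R A' (\<xi>' s))) (at s)"
      using \<xi> \<xi>' by (auto intro!: derivative_intros simp: extremal_def)
    then show ?thesis by (simp add: linear_diff[OF lin] algebra_simps)
  qed
  have "0 \<le> K"
  proof -
    obtain b :: 'a where "b \<in> Basis" by (meson nonempty_Basis ex_in_conv)
    then show ?thesis using order_trans[OF norm_ge_zero K[of b]] by simp
  qed
  fix r :: real assume r: "r \<in> {0..1}"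
  have "norm (?f r) \<le> norm (w - w') + 2 * (K * norm (\<xi>' r))"
    by (rule order_trans[OF norm_triangle_ineq]) (use K[of "\<xi>' r"] in simp)
  also have "\<dots> \<le> norm (w - w') + 2 * (K * (2 * norm w'))"
    using skew_map.extremal_norm_le[OF assms(3) \<xi>' r] \<open>0 \<le> K\<close>
    by (intro add_left_mono mult_left_mono) auto
  finally show "norm (?f r) \<le> norm (w - w') + 4 * K * norm w'" by simp
qed

lemma extremal_unique:
  assumes "extremal A w \<xi>" "extremal A w \<xi>'" "s \<in> {0..1}"
  shows "\<xi> s = \<xi>' s"
  using extremal_stability[OF assms(1,2) skew_map_axioms _ assms(3), of 0] by simp

text \<open>The velocity v solves v' = 2 A v, and a skew flow preserves the norm.\<close>

lemma extremal_speed: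
  assumes \<xi>: "extremal A w \<xi>"
  shows "norm (w + 2 *\<^sub>R A (\<xi> s)) = norm w"
proof -
  let ?v = "\<lambda>s. w + 2 *\<^sub>R A (\<xi> s)"
  have "(?v has_vector_derivative 2 *\<^sub>R A (?v r)) (at r)" for r
    using \<xi> A_has_vector_derivative[of \<xi> "?v r" r]
    by (auto intro!: derivative_eq_intros simp: extremal_def)
  from inner_has_real_derivative[OF this this]
  have "((\<lambda>s. ?v s \<bullet> ?v s) has_real_derivative 0) (at r)" for r by simp
  then have "?v s \<bullet> ?v s = ?v 0 \<bullet> ?v 0" using DERIV_isconst_all by blast
  moreover have "?v 0 = w" using \<xi> by (simp add: extremal_def linear_0[OF lin])
  ultimately show ?thesis by (simp add: norm_eq_sqrt_inner)
qed

text \<open>By constancy of speed the integrand equals \<open>(norm w)\<^sup>2\<close> minus the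
  product of the velocity with \<open>w\<close>, and this is an exact derivative.\<close>

lemma extremal_energy:
  assumes \<xi>: "extremal A w \<xi>"
  shows "((\<lambda>s. 2 * (A (\<xi> s) \<bullet> (w + 2 *\<^sub>R A (\<xi> s)))) has_integral (norm w)\<^sup>2 - \<xi> 1 \<bullet> w) {0..1}"
proof -
  let ?v = "\<lambda>s. w + 2 *\<^sub>R A (\<xi> s)"
  let ?F = "\<lambda>s. s * (norm w)\<^sup>2 - \<xi> s \<bullet> w"
  have "(?F has_real_derivative 2 * (A (\<xi> s) \<bullet> ?v s)) (at s)" for s
  proof -
    have "(\<xi> has_vector_derivative ?v s) (at s)" using \<xi> by (simp add: extremal_def)
    from inner_has_real_derivative[OF this has_vector_derivative_const[of w]]
    have "(?F has_real_derivative (norm w)\<^sup>2 - ?v s \<bullet> w) (at s)"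
      by (auto intro!: derivative_eq_intros)
    moreover have "(norm w)\<^sup>2 = ?v s \<bullet> ?v s"
      using extremal_speed[OF \<xi>, of s] by (metis dot_square_norm)
    ultimately show ?thesis by (simp add: inner_simps inner_commute)
  qed
  then have "((\<lambda>s. 2 * (A (\<xi> s) \<bullet> ?v s)) has_integral ?F 1 - ?F 0) {0..1}"
    by (intro fundamental_theorem_of_calculus)
      (auto simp: has_real_derivative_iff_has_vector_derivative intro: has_vector_derivative_at_within)
  then show ?thesis using \<xi> by (simp add: extremal_def)
qed

end

section \<open>Calibration of polygons\<close>

text \<open>The coefficient \<open>c tan (c (s - 1/2))\<close> solves \<open>f' = c\<^sup>2 + f\<^sup>2\<close>, which completes the square in
  the second variation; it is finite on \<open>[0, 1]\<close> because \<open>c < \<pi>\<close>.\<close>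

definition calibration :: "('a::real_inner \<Rightarrow> 'a) \<Rightarrow> 'a \<Rightarrow> (real \<Rightarrow> 'a) \<Rightarrow> real \<Rightarrow> real \<Rightarrow> 'a \<Rightarrow> real" where
  "calibration A w \<xi> c s y = \<xi> s \<bullet> w + 2 * ((w + A (\<xi> s)) \<bullet> (y - \<xi> s))
     - c * tan (c * (s - 1 / 2)) * ((y - \<xi> s) \<bullet> (y - \<xi> s))"

text \<open>Here \<open>h\<close> is the deviation from the extremal, \<open>k\<close> its
  derivative, \<open>v\<close> the velocity of the extremal, and \<open>a\<close>, \<open>b\<close>,
  \<open>d\<close> are the images under \<open>A\<close> of its position, of \<open>h\<close> and of
  \<open>v\<close>. The left side is the Lagrangian along the perturbed curve minus the derivative
  of the calibration. With \<open>f' = c\<^sup>2 + f\<^sup>2\<close> the right side is nonnegative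
  as soon as \<open>norm b\<close> is at most \<open>c * norm h\<close>.\<close>

lemma calibration_square_identity:
  fixes a b d h k v :: "'a::real_inner" and f f' :: real
  assumes "b \<bullet> v = - (h \<bullet> d)" "h \<bullet> b = 0"
  shows "(k + v) \<bullet> (k + v) - 2 * ((a + b) \<bullet> (k + v))
      - (v \<bullet> (v - 2 *\<^sub>R a) + 2 * ((v - a) \<bullet> k + d \<bullet> h) - (f' * (h \<bullet> h) + f * (2 * (h \<bullet> k))))
    = (k + f *\<^sub>R h - b) \<bullet> (k + f *\<^sub>R h - b) + (f' - f\<^sup>2) * (h \<bullet> h) - b \<bullet> b"
  using assms by (simp add: inner_simps inner_commute power2_eq_square algebra_simps)

context skew_map
begin

lemma calibration_segment:
  assumes \<xi>: "extremal A w \<xi>" and c: "\<And>x. norm (A x) \<le> c * norm x" "0 < c" "c < pi"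
    and \<theta>: "0 \<le> \<theta>" "\<theta> < \<theta>'" "\<theta>' \<le> 1"
  shows "calibration A w \<xi> c \<theta>' y' - calibration A w \<xi> c \<theta> y
    \<le> (norm (y' - y))\<^sup>2 / (\<theta>' - \<theta>) - 2 * (A y \<bullet> (y' - y))"
proof -
  define u where "u = (y' - y) /\<^sub>R (\<theta>' - \<theta>)"
  have u: "(\<theta>' - \<theta>) *\<^sub>R u = y' - y" using \<theta> by (simp add: u_def)
  let ?x = "\<lambda>s. y + (s - \<theta>) *\<^sub>R u"
  \<comment> \<open>Action along the segment minus calibration. The Lagrangian is constant on a
    segment, since \<open>A u \<bullet> u = 0\<close> allows \<open>A\<close> to be evaluated at the
    initial point \<open>y\<close>.\<close>
  let ?D = "\<lambda>s. s * (u \<bullet> u - 2 * (A y \<bullet> u)) - calibration A w \<xi> c s (?x s)"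
  have "\<exists>D'. (?D has_real_derivative D') (at s) \<and> 0 \<le> D'" if s: "\<theta> \<le> s" "s \<le> \<theta>'" for s
  proof -
    define v where "v = w + 2 *\<^sub>R A (\<xi> s)"
    define h where "h = ?x s - \<xi> s"
    define f where "f = c * tan (c * (s - 1 / 2))"
    define f' where "f' = c\<^sup>2 + f\<^sup>2"
    have d\<xi>: "(\<xi> has_vector_derivative v) (at s)" using \<xi> by (simp add: extremal_def v_def)
    have dh: "((\<lambda>s. ?x s - \<xi> s) has_vector_derivative (u - v)) (at s)"
      using d\<xi> by (auto intro!: derivative_eq_intros)
    have dA: "((\<lambda>s. w + A (\<xi> s)) has_vector_derivative A v) (at s)"
      using A_has_vector_derivative[OF d\<xi>] by (auto intro!: derivative_eq_intros)
    have "\<bar>s - 1 / 2\<bar> \<le> 1 / 2" using s \<theta> by linarith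
    then have "\<bar>c * (s - 1 / 2)\<bar> \<le> c * (1 / 2)"
      using c(2) unfolding abs_mult by (intro mult_mono) auto
    then have "\<bar>c * (s - 1 / 2)\<bar> < pi / 2" using c(3) by simp
    then have "0 < cos (c * (s - 1 / 2))" by (intro cos_gt_zero_pi) linarith+
    then have cos: "cos (c * (s - 1 / 2)) \<noteq> 0" by simp
    have "((\<lambda>s. c * tan (c * (s - 1 / 2))) has_real_derivative
        c * (inverse ((cos (c * (s - 1 / 2)))\<^sup>2) * c)) (at s)"
      using cos by (auto intro!: derivative_eq_intros)
    also have "c * (inverse ((cos (c * (s - 1 / 2)))\<^sup>2) * c) = f'"
      unfolding f'_def f_def power_mult_distrib power_inverse[symmetric] tan_sec[OF cos, symmetric]
      by (simp add: power2_eq_square algebra_simps)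
    finally have df: "((\<lambda>s. c * tan (c * (s - 1 / 2))) has_real_derivative f') (at s)" .
    define D where "D = v \<bullet> w + 2 * ((w + A (\<xi> s)) \<bullet> (u - v) + A v \<bullet> h)
        - (f' * (h \<bullet> h) + f * (2 * (h \<bullet> (u - v))))"
    have dG: "((\<lambda>s. calibration A w \<xi> c s (?x s)) has_real_derivative D) (at s)"
      unfolding calibration_def D_def h_def f_def
      by (rule derivative_eq_intros df inner_has_real_derivative[OF d\<xi> has_vector_derivative_const]
          inner_has_real_derivative[OF dA dh] inner_has_real_derivative[OF dh dh] refl)+
        (simp add: inner_commute algebra_simps)
    have dD: "(?D has_real_derivative (u \<bullet> u - 2 * (A y \<bullet> u)) - D) (at s)"
      by (rule derivative_eq_intros dG refl)+ simp
    have v: "v - 2 *\<^sub>R A (\<xi> s) = w" "v - A (\<xi> s) = w + A (\<xi> s)"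
      by (simp_all add: v_def scaleR_2)
    have Ay: "A y \<bullet> u = (A (\<xi> s) + A h) \<bullet> u"
      by (simp add: h_def linear_add[OF lin] linear_diff[OF lin] linear_scale[OF lin] inner_simps)
    have "(u \<bullet> u - 2 * (A y \<bullet> u)) - D
        = (u - v + f *\<^sub>R h - A h) \<bullet> (u - v + f *\<^sub>R h - A h) + (f' - f\<^sup>2) * (h \<bullet> h) - A h \<bullet> A h"
      using calibration_square_identity[of "A h" v h "A v" "u - v" "A (\<xi> s)" f' f] skew[of h v]
      unfolding Ay D_def v by simp
    moreover have "A h \<bullet> A h \<le> (f' - f\<^sup>2) * (h \<bullet> h)"
    proof -
      have "(norm (A h))\<^sup>2 \<le> (c * norm h)\<^sup>2" by (rule power_mono[OF c(1)]) simp
      then show ?thesis by (simp add: f'_def power_mult_distrib dot_square_norm)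
    qed
    ultimately have "0 \<le> (u \<bullet> u - 2 * (A y \<bullet> u)) - D"
      by (smt (verit) inner_ge_zero)
    then show ?thesis using dD by blast
  qed
  then have "?D \<theta> \<le> ?D \<theta>'"
    using DERIV_nonneg_imp_nondecreasing[of \<theta> \<theta>' ?D] \<theta> by auto
  then have "calibration A w \<xi> c \<theta>' (y + (\<theta>' - \<theta>) *\<^sub>R u) - calibration A w \<xi> c \<theta> y
      \<le> (\<theta>' - \<theta>) * (u \<bullet> u - 2 * (A y \<bullet> u))"
    by (simp add: algebra_simps)
  also have "(\<theta>' - \<theta>) * (u \<bullet> u - 2 * (A y \<bullet> u))
      = (\<theta>' - \<theta>) * (u \<bullet> u) - 2 * (A y \<bullet> ((\<theta>' - \<theta>) *\<^sub>R u))"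
    by (simp add: algebra_simps)
  also have "(\<theta>' - \<theta>) * (u \<bullet> u) = (norm (y' - y))\<^sup>2 / (\<theta>' - \<theta>)"
    using \<theta> by (simp add: u_def dot_square_norm power_mult_distrib divide_simps power2_eq_square)
  finally show ?thesis unfolding u by simp
qed

text \<open>The segment estimates telescope: the calibration is 0 at the start, and at the end,
  where polygon and extremal meet, only \<open>\<xi> 1 \<bullet> w\<close> remains.\<close>

lemma polygon_bound:
  assumes \<xi>: "extremal A w \<xi>" and c: "\<And>x. norm (A x) \<le> c * norm x" "0 < c" "c < pi"
    and y: "y 0 = 0" "y n = \<xi> 1"
  shows "\<xi> 1 \<bullet> w + 2 * (\<Sum>i<n. A (y i) \<bullet> (y (Suc i) - y i)) \<le> (\<Sum>i<n. norm (y (Suc i) - y i))\<^sup>2"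
proof -
  define d where "d i = norm (y (Suc i) - y i)" for i
  define L where "L = (\<Sum>i<n. d i)"
  have d: "0 \<le> d i" for i by (simp add: d_def)
  show ?thesis
  proof (cases "L = 0")
    case True
    then have d0: "\<forall>i<n. y (Suc i) = y i"
      using d by (auto simp: L_def sum_nonneg_eq_0_iff d_def)
    have "y i = 0" if "i \<le> n" for i using that by (induction i) (use d0 y in auto)
    then have "\<xi> 1 = 0" using y by auto
    then show ?thesis using d0 by simp
  next
    case False
    then have L: "L > 0" using sum_nonneg[of "{..<n}" d] d by (simp add: L_def)
    \<comment> \<open>Time proportional to accumulated length: a piece of length \<open>d i\<close>
      takes time \<open>d i / L\<close> and costs \<open>L * d i\<close>, so the total cost is
      exactly the square of the length.\<close>
    define \<theta> where "\<theta> i = (\<Sum>k<i. d k) / L" for i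
    have \<theta>0: "\<theta> 0 = 0" and \<theta>n: "\<theta> n = 1" using L by (auto simp: \<theta>_def L_def)
    have \<theta>S: "\<theta> (Suc i) - \<theta> i = d i / L" for i by (simp add: \<theta>_def diff_divide_distrib[symmetric])
    have \<theta>nn: "0 \<le> \<theta> i" for i using d L by (simp add: \<theta>_def sum_nonneg)
    have \<theta>le: "\<theta> i \<le> 1" if "i \<le> n" for i
    proof -
      have "(\<Sum>k<i. d k) \<le> L" unfolding L_def using that d by (intro sum_mono2) auto
      then show ?thesis using L by (simp add: \<theta>_def)
    qed
    let ?G = "\<lambda>i. calibration A w \<xi> c (\<theta> i) (y i)"
    have step: "?G (Suc i) - ?G i \<le> L * d i - 2 * (A (y i) \<bullet> (y (Suc i) - y i))" if i: "i < n" for i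
    proof (cases "d i = 0")
      case True
      then have "y (Suc i) = y i" "\<theta> (Suc i) = \<theta> i" using \<theta>S[of i] by (auto simp: d_def)
      then show ?thesis using True by simp
    next
      case False
      then have di: "d i > 0" using d[of i] by simp
      then have "\<theta> i < \<theta> (Suc i)" using \<theta>S[of i] L by (smt (verit) divide_pos_pos)
      from calibration_segment[OF \<xi> c \<theta>nn this \<theta>le, of "y (Suc i)" "y i"]
      have "?G (Suc i) - ?G i \<le> (d i)\<^sup>2 / (d i / L) - 2 * (A (y i) \<bullet> (y (Suc i) - y i))"
        using i by (simp add: \<theta>S d_def)
      then show ?thesis using di L by (simp add: power2_eq_square mult.commute)
    qed
    have "?G n - ?G 0 = (\<Sum>i<n. ?G (Suc i) - ?G i)" by (rule sum_lessThan_telescope[symmetric])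
    also have "\<dots> \<le> (\<Sum>i<n. L * d i - 2 * (A (y i) \<bullet> (y (Suc i) - y i)))"
      by (rule sum_mono) (use step in auto)
    also have "\<dots> = L * L - 2 * (\<Sum>i<n. A (y i) \<bullet> (y (Suc i) - y i))"
      by (simp add: sum_subtractf L_def flip: sum_distrib_left)
    finally have "?G n - ?G 0 \<le> L * L - 2 * (\<Sum>i<n. A (y i) \<bullet> (y (Suc i) - y i))" .
    moreover have "?G n = \<xi> 1 \<bullet> w" "?G 0 = 0"
      using \<xi> by (auto simp: calibration_def \<theta>0 \<theta>n y extremal_def)
    ultimately show ?thesis by (simp add: L_def d_def power2_eq_square)
  qed
qed

end

section \<open>Length of horizontal curves\<close>

lemma abs_cont_on_bounded_linear:
  assumes f: "abs_cont_on a b f" and T: "bounded_linear T"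
  shows "abs_cont_on a b (\<lambda>s. T (f s))"
  unfolding abs_cont_on_def
proof (intro allI impI)
  fix \<epsilon> :: real assume \<epsilon>: "\<epsilon> > 0"
  obtain K where K: "K > 0" "\<And>x. norm (T x) \<le> norm x * K" using bounded_linear.pos_bounded[OF T] by blast
  have "\<epsilon> / K > 0" using \<epsilon> K by simp
  from f[unfolded abs_cont_on_def, rule_format, OF this]
  obtain \<delta> where \<delta>: "\<delta> > 0" "\<forall>(n::nat) l r. (\<forall>k<n. a \<le> l k \<and> l k \<le> r k \<and> r k \<le> b) \<and>
      (\<forall>i<n. \<forall>j<n. i \<noteq> j \<longrightarrow> r i \<le> l j \<or> r j \<le> l i) \<and> (\<Sum>k<n. r k - l k) < \<delta>
      \<longrightarrow> (\<Sum>k<n. norm (f (r k) - f (l k))) < \<epsilon> / K" by (elim exE conjE) (rule that)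
  show "\<exists>\<delta>>0. \<forall>(n::nat) l r. (\<forall>k<n. a \<le> l k \<and> l k \<le> r k \<and> r k \<le> b) \<and>
      (\<forall>i<n. \<forall>j<n. i \<noteq> j \<longrightarrow> r i \<le> l j \<or> r j \<le> l i) \<and> (\<Sum>k<n. r k - l k) < \<delta>
      \<longrightarrow> (\<Sum>k<n. norm (T (f (r k)) - T (f (l k)))) < \<epsilon>"
  proof (intro exI[of _ \<delta>] conjI allI impI \<delta>(1))
    fix n :: nat and l r :: "nat \<Rightarrow> real"
    assume "(\<forall>k<n. a \<le> l k \<and> l k \<le> r k \<and> r k \<le> b) \<and>
      (\<forall>i<n. \<forall>j<n. i \<noteq> j \<longrightarrow> r i \<le> l j \<or> r j \<le> l i) \<and> (\<Sum>k<n. r k - l k) < \<delta>"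
    from \<delta>(2)[rule_format, OF this]
    have *: "(\<Sum>k<n. norm (f (r k) - f (l k))) < \<epsilon> / K" .
    have "(\<Sum>k<n. norm (T (f (r k)) - T (f (l k)))) \<le> (\<Sum>k<n. norm (f (r k) - f (l k)) * K)"
      using K(2) by (intro sum_mono) (simp flip: linear_diff[OF bounded_linear.linear[OF T]])
    also have "\<dots> = (\<Sum>k<n. norm (f (r k) - f (l k))) * K" by (simp add: sum_distrib_right)
    also have "\<dots> < \<epsilon>" using * K(1) by (simp add: field_simps)
    finally show "(\<Sum>k<n. norm (T (f (r k)) - T (f (l k)))) < \<epsilon>" .
  qed
qed

lemma skewmat_inner:
  "(skewmat U \<tau> *v x) \<bullet> y = (\<Sum>j\<in>UNIV. \<tau> $ j * ((U j *v x) \<bullet> y))"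
proof -
  have "(\<Sum>j\<in>S. \<tau> $ j *\<^sub>R U j) *v x = (\<Sum>j\<in>S. \<tau> $ j *\<^sub>R (U j *v x))" for S
    by (induction S rule: infinite_finite_induct)
      (auto simp: matrix_vector_mult_add_rdistrib scaleR_matrix_vector_assoc)
  then show ?thesis by (simp add: skewmat_def inner_sum_left)
qed

text \<open>The second bound replaces an arc by its chord in the vertical coordinate. The error is
  quadratic in the length of the arc, so it becomes negligible when summed over a fine
  partition.\<close>

lemma curve_segment_bounds:
  fixes U :: "'m::finite \<Rightarrow> real^'q::finite^'q"
  assumes \<gamma>: "horizontal_curve U g \<gamma> v" and lr: "0 \<le> l" "l \<le> r" "r \<le> 1"
    and c: "\<And>x. norm (skewmat U \<tau> *v x) \<le> c * norm x" "0 \<le> c"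
  defines "I \<equiv> integral {l..r} (\<lambda>s. norm (v s))"
  shows "norm (fst (\<gamma> r) - fst (\<gamma> l)) \<le> I"
    and "4 * ((snd (\<gamma> r) - snd (\<gamma> l)) \<bullet> \<tau>)
      \<le> 2 * ((skewmat U \<tau> *v fst (\<gamma> l)) \<bullet> (fst (\<gamma> r) - fst (\<gamma> l))) + 2 * c * I\<^sup>2"
proof -
  let ?A = "\<lambda>x. skewmat U \<tau> *v x"
  have ac: "abs_cont_on 0 1 \<gamma>"
    and ae: "AE s in lebesgue. s \<in> {0..1} \<longrightarrow>
        ((\<lambda>r. fst (\<gamma> r)) has_vector_derivative v s) (at s) \<and>
        ((\<lambda>r. snd (\<gamma> r)) has_vector_derivative (\<chi> j. (1/2) * ((U j *v fst (\<gamma> s)) \<bullet> v s))) (at s)"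
    and int: "(\<lambda>s. norm (v s)) integrable_on {0..1}"
    using \<gamma> by (auto simp: horizontal_curve_def)
  have int': "(\<lambda>s. norm (v s)) integrable_on {a..b}" if "0 \<le> a" "b \<le> 1" for a b
    by (rule integrable_on_subinterval[OF int]) (use that in auto)
  have X: "norm (fst (\<gamma> b) - fst (\<gamma> a)) \<le> integral {a..b} (\<lambda>s. norm (v s))"
    if ab: "0 \<le> a" "a \<le> b" "b \<le> 1" for a b
  proof (rule abs_cont_on_norm_bound[OF _ ab _ int'])
    show "abs_cont_on 0 1 (\<lambda>s. fst (\<gamma> s))"
      by (rule abs_cont_on_bounded_linear[OF ac bounded_linear_fst])
    show "AE s in lebesgue. s \<in> {a..b} \<longrightarrow>
        (\<exists>D. ((\<lambda>s. fst (\<gamma> s)) has_vector_derivative D) (at s) \<and> norm D \<le> norm (v s))"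
      using ae by eventually_elim (use ab in auto)
  qed (use ab in auto)
  show "norm (fst (\<gamma> r) - fst (\<gamma> l)) \<le> I" unfolding I_def by (rule X[OF lr])
  \<comment> \<open>The vertical coordinate with \<open>A\<close> frozen at the left endpoint
    subtracted. Its derivative
    \<open>2 * (?A (fst (\<gamma> s) - fst (\<gamma> l)) \<bullet> v s)\<close> contains a
    displacement of size at most \<open>I\<close>.\<close>
  define T where "T = (\<lambda>g::(real^'q) \<times> (real^'m). 4 * (snd g \<bullet> \<tau>) - 2 * (?A (fst (\<gamma> l)) \<bullet> fst g))"
  have T: "bounded_linear T"
    unfolding T_def by (intro bounded_linear_sub bounded_linear_const_mult
        bounded_linear_compose[OF bounded_linear_inner_left bounded_linear_snd]
        bounded_linear_compose[OF bounded_linear_inner_right bounded_linear_fst])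
  have "norm (T (\<gamma> r) - T (\<gamma> l)) \<le> integral {l..r} (\<lambda>s. 2 * c * I * norm (v s))"
  proof (rule abs_cont_on_norm_bound[OF abs_cont_on_bounded_linear[OF ac T] lr])
    show "AE s in lebesgue. s \<in> {l..r} \<longrightarrow>
        (\<exists>D. ((\<lambda>s. T (\<gamma> s)) has_vector_derivative D) (at s) \<and> norm D \<le> 2 * c * I * norm (v s))"
      using ae
    proof eventually_elim
      case (elim s)
      show ?case
      proof
        assume s: "s \<in> {l..r}"
        then have dX: "((\<lambda>r. fst (\<gamma> r)) has_vector_derivative v s) (at s)"
          and dS: "((\<lambda>r. snd (\<gamma> r)) has_vector_derivative (\<chi> j. (1/2) * ((U j *v fst (\<gamma> s)) \<bullet> v s))) (at s)"
          using elim lr by auto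
        let ?D = "4 * ((\<chi> j. (1/2) * ((U j *v fst (\<gamma> s)) \<bullet> v s)) \<bullet> \<tau>) - 2 * (?A (fst (\<gamma> l)) \<bullet> v s)"
        have "((\<lambda>s. T (\<gamma> s)) has_vector_derivative ?D) (at s)"
          unfolding T_def
          by (intro has_vector_derivative_diff has_vector_derivative_mult_right
              bounded_linear.has_vector_derivative[OF bounded_linear_inner_left dS]
              bounded_linear.has_vector_derivative[OF bounded_linear_inner_right dX])
        moreover have "?D = 2 * (?A (fst (\<gamma> s) - fst (\<gamma> l)) \<bullet> v s)"
          by (simp add: matrix_vector_mult_diff_distrib inner_diff_left skewmat_inner[of U \<tau> "fst (\<gamma> s)"]
              inner_vec_def[of "\<chi> j. _ j"] sum_distrib_left mult_ac)
        moreover have "norm (2 * (?A (fst (\<gamma> s) - fst (\<gamma> l)) \<bullet> v s)) \<le> 2 * c * I * norm (v s)"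
        proof -
          have "norm (fst (\<gamma> s) - fst (\<gamma> l)) \<le> integral {l..s} (\<lambda>s. norm (v s))"
            using X[of l s] s lr by auto
          also have "\<dots> \<le> I" unfolding I_def
            using s lr by (intro integral_subset_le int') auto
          finally have "norm (?A (fst (\<gamma> s) - fst (\<gamma> l))) \<le> c * I"
            using c by (meson mult_left_mono order_trans)
          then have "\<bar>?A (fst (\<gamma> s) - fst (\<gamma> l)) \<bullet> v s\<bar> \<le> c * I * norm (v s)"
            by (meson Cauchy_Schwarz_ineq2 mult_right_mono norm_ge_zero order_trans)
          then show ?thesis by simp
        qed
        ultimately show "\<exists>D. ((\<lambda>s. T (\<gamma> s)) has_vector_derivative D) (at s) \<and> norm D \<le> 2 * c * I * norm (v s)"
          by metis
      qed
    qed
    show "(\<lambda>s. 2 * c * I * norm (v s)) integrable_on {l..r}"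
      using int' lr by (intro integrable_on_mult_right) auto
  qed
  also have "\<dots> = 2 * c * I\<^sup>2" by (simp add: I_def power2_eq_square)
  finally show "4 * ((snd (\<gamma> r) - snd (\<gamma> l)) \<bullet> \<tau>)
      \<le> 2 * ((skewmat U \<tau> *v fst (\<gamma> l)) \<bullet> (fst (\<gamma> r) - fst (\<gamma> l))) + 2 * c * I\<^sup>2"
    unfolding T_def by (simp add: inner_diff_left inner_diff_right algebra_simps)
qed

lemma curve_length_bound:
  fixes U :: "'m::finite \<Rightarrow> real^'q::finite^'q"
  assumes \<gamma>: "horizontal_curve U (x, t) \<gamma> v"
    and A: "skew_map (\<lambda>x. skewmat U \<tau> *v x)"
    and c: "\<And>x. norm (skewmat U \<tau> *v x) \<le> c * norm x" "0 < c" "c < pi"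
    and \<xi>: "extremal (\<lambda>x. skewmat U \<tau> *v x) w \<xi>" "\<xi> 1 = x"
  shows "x \<bullet> w + 4 * (t \<bullet> \<tau>) \<le> (integral {0..1} (\<lambda>s. norm (v s)))\<^sup>2" (is "_ \<le> ?L\<^sup>2")
proof (rule field_le_epsilon)
  fix e0 :: real assume e0: "e0 > 0"
  let ?A = "\<lambda>x. skewmat U \<tau> *v x"
  have int: "(\<lambda>s. norm (v s)) integrable_on {0..1}" and ends: "\<gamma> 0 = (0, 0)" "\<gamma> 1 = (x, t)"
    using \<gamma> by (auto simp: horizontal_curve_def)
  have L0: "?L \<ge> 0" by (rule integral_nonneg[OF int]) simp
  \<comment> \<open>Arcs of length at most \<epsilon> produce a total error of at most
    \<open>2 * c * \<epsilon> * ?L\<close>, which this choice keeps below \<open>e0\<close>; the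
    summand 1 covers \<open>?L = 0\<close>.\<close>
  define \<epsilon> where "\<epsilon> = e0 / (2 * c * ?L + 1)"
  have \<epsilon>: "\<epsilon> > 0" using e0 c(2) L0 by (simp add: \<epsilon>_def add_nonneg_pos)
  define \<Lambda> where "\<Lambda> r = integral {0..r} (\<lambda>s. norm (v s))" for r
  have \<Lambda>: "integral {l..r} (\<lambda>s. norm (v s)) = \<Lambda> r - \<Lambda> l" if "0 \<le> l" "l \<le> r" "r \<le> 1" for l r
  proof -
    have "(\<lambda>s. norm (v s)) integrable_on {0..r}"
      by (rule integrable_on_subinterval[OF int]) (use that in auto)
    from Henstock_Kurzweil_Integration.integral_combine[OF that(1,2) this] show ?thesis
      by (simp add: \<Lambda>_def)
  qed
  have "uniformly_continuous_on {0..1} \<Lambda>"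
    unfolding \<Lambda>_def using indefinite_integral_continuous_1[OF int]
    by (intro compact_uniformly_continuous) auto
  then obtain d where d: "d > 0"
    and close: "\<And>a b. \<lbrakk>a \<in> {0..1}; b \<in> {0..1}; dist b a < d\<rbrakk> \<Longrightarrow> dist (\<Lambda> b) (\<Lambda> a) < \<epsilon>"
    using \<epsilon> unfolding uniformly_continuous_on_def by metis
  obtain m where m: "inverse (real (Suc m)) < d" using reals_Archimedean[OF d] by blast
  define n where "n = Suc m"
  define s where "s i = real i / real n" for i
  have s: "0 \<le> s i" "s i \<le> s (Suc i)" "s (Suc i) \<le> 1" "dist (s (Suc i)) (s i) < d" if "i < n" for i
    using that m by (auto simp: s_def n_def dist_real_def divide_right_mono diff_divide_distrib[symmetric]
        inverse_eq_divide)
  have s0: "s 0 = 0" "s n = 1" by (auto simp: s_def n_def)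
  define y where "y i = fst (\<gamma> (s i))" for i
  define z where "z i = snd (\<gamma> (s i))" for i
  define D where "D i = \<Lambda> (s (Suc i)) - \<Lambda> (s i)" for i
  have seg: "norm (y (Suc i) - y i) \<le> D i"
    "4 * ((z (Suc i) - z i) \<bullet> \<tau>) \<le> 2 * (?A (y i) \<bullet> (y (Suc i) - y i)) + 2 * c * (D i)\<^sup>2"
    if "i < n" for i
    using curve_segment_bounds[OF \<gamma> s(1-3)[OF that] c(1)] c(2) \<Lambda>[OF s(1-3)[OF that]]
    by (auto simp: y_def z_def D_def)
  have D0: "0 \<le> D i" if "i < n" for i using seg(1)[OF that] norm_ge_zero order_trans by blast
  have De: "D i \<le> \<epsilon>" if "i < n" for i
    using close[of "s i" "s (Suc i)"] s[OF that] by (auto simp: D_def dist_real_def)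
  have sumD: "(\<Sum>i<n. D i) = ?L"
    unfolding D_def by (subst sum_lessThan_telescope) (simp add: s0 \<Lambda>_def)
  have "(\<Sum>i<n. 4 * ((z (Suc i) - z i) \<bullet> \<tau>)) = 4 * ((\<Sum>i<n. z (Suc i) - z i) \<bullet> \<tau>)"
    by (simp add: inner_sum_left sum_distrib_left)
  also have "\<dots> = 4 * (t \<bullet> \<tau>)"
    by (subst sum_lessThan_telescope) (simp add: z_def s0 ends)
  finally have "x \<bullet> w + 4 * (t \<bullet> \<tau>) = x \<bullet> w + (\<Sum>i<n. 4 * ((z (Suc i) - z i) \<bullet> \<tau>))" by simp
  also have "\<dots> \<le> x \<bullet> w + (\<Sum>i<n. 2 * (?A (y i) \<bullet> (y (Suc i) - y i)) + 2 * c * (\<epsilon> * D i))"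
  proof (intro add_left_mono sum_mono)
    fix i assume "i \<in> {..<n}"
    then have i: "i < n" by simp
    have "2 * c * (D i)\<^sup>2 \<le> 2 * c * (\<epsilon> * D i)"
      unfolding power2_eq_square using c(2) De[OF i] D0[OF i] by (intro mult_left_mono mult_right_mono) auto
    then show "4 * ((z (Suc i) - z i) \<bullet> \<tau>) \<le> 2 * (?A (y i) \<bullet> (y (Suc i) - y i)) + 2 * c * (\<epsilon> * D i)"
      using seg(2)[OF i] by linarith
  qed
  also have "\<dots> = (x \<bullet> w + 2 * (\<Sum>i<n. ?A (y i) \<bullet> (y (Suc i) - y i))) + 2 * c * (\<epsilon> * ?L)"
    by (simp add: sum.distrib sumD flip: sum_distrib_left)
  also have "x \<bullet> w + 2 * (\<Sum>i<n. ?A (y i) \<bullet> (y (Suc i) - y i)) \<le> (\<Sum>i<n. norm (y (Suc i) - y i))\<^sup>2"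
    using skew_map.polygon_bound[OF A \<xi>(1) c, of y n] by (simp add: \<xi>(2) y_def s0 ends)
  also have "\<dots> \<le> ?L\<^sup>2"
    unfolding sumD[symmetric] by (intro power_mono sum_mono seg sum_nonneg) auto
  also have "2 * c * (\<epsilon> * ?L) \<le> e0"
    using e0 c(2) L0 by (simp add: \<epsilon>_def divide_simps add_nonneg_pos mult_ac)
  finally show "x \<bullet> w + 4 * (t \<bullet> \<tau>) \<le> ?L\<^sup>2 + e0" by simp
qed

section \<open>Bounds on phi\<close>

text \<open>Concavity of the sine on [0, \<pi>]: its graph lies above the chord from 0 to
  \<open>c\<close>.\<close>

lemma sin_chord_le:
  fixes l c :: real
  assumes "0 \<le> l" "l \<le> c" "0 < c" "c < pi"
  shows "l * sin c \<le> c * sin l"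
proof -
  have "convex_on {0..pi} (\<lambda>x. - sin x :: real)"
    by (rule f''_ge0_imp_convex[where f' = "\<lambda>x. - cos x" and f'' = sin])
      (auto intro!: derivative_eq_intros sin_ge_zero)
  from convex_onD[OF this, of "l / c" 0 c] show ?thesis
    using assms by (simp add: field_simps)
qed

lemma real_zcot_bounded:
  assumes "0 < c" "c < pi" "0 \<le> l" "l \<le> c"
  shows "\<bar>real_zcot l\<bar> \<le> 1 + c / sin c"
proof (cases "l = 0")
  case True
  then show ?thesis using assms sin_gt_zero[of c] by (simp add: real_zcot_def)
next
  case False
  then have sl: "sin l > 0" and sc: "sin c > 0" using assms by (auto intro!: sin_gt_zero)
  have "\<bar>real_zcot l\<bar> = l / sin l * \<bar>cos l\<bar>"
    using False sl assms by (simp add: real_zcot_def cot_def abs_mult)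
  also have "\<dots> \<le> l / sin l * 1"
    using sl assms by (intro mult_left_mono) auto
  also have "l / sin l \<le> c / sin c"
    using sin_chord_le[of l c] assms sl sc by (simp add: field_simps)
  finally show ?thesis by simp
qed

lemma real_zcot_scale_ge:
  assumes "0 \<le> l" "l < pi" "0 < r" "r \<le> 1"
  shows "r * real_zcot l \<le> real_zcot (r * l)"
proof (cases "l = 0")
  case True
  then show ?thesis using assms by (simp add: real_zcot_def)
next
  case False
  then have l: "0 < l" "0 < r * l" "r * l \<le> l"
    using assms by (auto intro: mult_left_le_one_le)
  then have s: "sin l > 0" "sin (r * l) > 0" using assms by (auto intro!: sin_gt_zero)
  have "0 \<le> sin (l - r * l)" using l assms by (intro sin_ge_zero) linarith+
  then have "cot l \<le> cot (r * l)"
    using s by (simp add: cot_def field_simps sin_diff)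
  then show ?thesis using l assms by (simp add: real_zcot_def mult_left_mono)
qed

text \<open>For \<open>f e = real_zcot (l e)\<close> this operator is U(\<tau>) cot U(\<tau>)
  restricted to real vectors.\<close>

lemma skew_eigenbasis_operator:
  fixes A :: "'a::euclidean_space \<Rightarrow> 'a"
  assumes basis: "skew_eigenbasis A B l" and f: "\<forall>e\<in>B. \<bar>f e\<bar> \<le> C" "0 \<le> C"
  defines "Z \<equiv> \<lambda>x. \<Sum>e\<in>B. (f e * (x \<bullet> e)) *\<^sub>R e"
  shows "linear Z" "Z a \<bullet> b = a \<bullet> Z b" "norm (Z a) \<le> C * norm a" "Z a \<bullet> a = (\<Sum>e\<in>B. f e * (a \<bullet> e)\<^sup>2)"
proof -
  note B = skew_eigenbasisD[OF basis]
  show "linear Z" unfolding Z_def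
    by (intro linearI) (auto simp: inner_simps algebra_simps sum.distrib scaleR_sum_right)
  show "Z a \<bullet> b = a \<bullet> Z b"
    unfolding Z_def by (simp add: inner_sum_left inner_sum_right inner_commute mult_ac)
  show "Z a \<bullet> a = (\<Sum>e\<in>B. f e * (a \<bullet> e)\<^sup>2)"
    unfolding Z_def by (simp add: inner_sum_left inner_sum_right inner_commute power2_eq_square mult_ac)
  have nrm: "(norm (\<Sum>e\<in>B. g e *\<^sub>R e))\<^sup>2 = (\<Sum>e\<in>B. (g e)\<^sup>2)" for g
  proof -
    have "pairwise (\<lambda>i j. orthogonal (g i *\<^sub>R i) (g j *\<^sub>R j)) B"
      using B(2) by (auto simp: pairwise_def orthogonal_def)
    from norm_sum_Pythagorean[OF B(1) this] show ?thesis by (simp add: B(3) power_mult_distrib)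
  qed
  have "(norm (Z a))\<^sup>2 = (\<Sum>e\<in>B. (f e)\<^sup>2 * (a \<bullet> e)\<^sup>2)"
    unfolding Z_def nrm by (simp add: power_mult_distrib)
  also have "\<dots> \<le> (\<Sum>e\<in>B. C\<^sup>2 * (a \<bullet> e)\<^sup>2)"
    using f by (intro sum_mono mult_right_mono) (auto simp: abs_le_square_iff[symmetric])
  also have "\<dots> = (C * norm a)\<^sup>2"
    using nrm[of "\<lambda>e. a \<bullet> e"] by (simp add: B(6) power_mult_distrib flip: sum_distrib_left)
  finally show "norm (Z a) \<le> C * norm a"
    using f(2) by (simp add: abs_le_square_iff[symmetric])
qed

lemma norm_cvec: "norm (cvec x) = norm x"
  by (simp add: norm_vec_def cvec_def)

lemma norm_ii_cvec: "norm (\<i> *s v) = norm v" for v :: "complex^'n"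
  by (simp add: norm_vec_def norm_mult)

section \<open>The parameter norm on the group and bounds on \<open>phi\<close> uniform in the
  parameter\<close>

locale step_two_group =
  fixes U :: "'m::finite \<Rightarrow> real^'q::finite^'q"
  assumes skewU: "transpose (U j) = - U j"
begin

abbreviation A :: "real^'m \<Rightarrow> real^'q \<Rightarrow> real^'q" where
  "A \<tau> \<equiv> \<lambda>x. skewmat U \<tau> *v x"

lemma transpose_skewmat: "transpose (skewmat U \<tau>) = - skewmat U \<tau>"
proof -
  have *: "skewmat U \<tau> $ j $ i = - skewmat U \<tau> $ i $ j" for i j
  proof -
    have "\<tau> $ k * U k $ j $ i = - (\<tau> $ k * U k $ i $ j)" for k
      using transpose_uminus_nth[OF skewU[of k], of j i] by simp
    then have "(\<Sum>k\<in>UNIV. \<tau> $ k * U k $ j $ i) = (\<Sum>k\<in>UNIV. - (\<tau> $ k * U k $ i $ j))"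
      by (rule sum.cong[OF refl])
    then show ?thesis by (simp add: skewmat_def sum_negf)
  qed
  have "transpose (skewmat U \<tau>) $ i $ j = (- skewmat U \<tau>) $ i $ j" for i j
    using *[of i j] by (simp add: transpose_def)
  then show ?thesis by (simp add: vec_eq_iff)
qed

lemma skew_map_A: "skew_map (A \<tau>)"
proof (rule skew_map.intro)
  show "linear (A \<tau>)" by simp
  show "A \<tau> x \<bullet> y = - (x \<bullet> A \<tau> y)" for x y
  proof -
    have "(- skewmat U \<tau>) *v y = - A \<tau> y"
      by (simp add: vec_eq_iff matrix_vector_mult_def sum_negf)
    then show ?thesis
      using dot_lmul_matrix[of x "transpose (skewmat U \<tau>)" y, unfolded vector_transpose_matrix]
      by (simp add: transpose_skewmat)
  qed
qed

lemma skewmat_add: "skewmat U (\<sigma> + \<tau>) = skewmat U \<sigma> + skewmat U \<tau>"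
  by (simp add: skewmat_def scaleR_add_left sum.distrib)

lemma skewmat_scale: "skewmat U (r *\<^sub>R \<tau>) = r *\<^sub>R skewmat U \<tau>"
  by (simp add: skewmat_def scaleR_sum_right)

lemma A_add: "A (\<sigma> + \<tau>) x = A \<sigma> x + A \<tau> x"
  by (simp add: skewmat_add matrix_vector_mult_add_rdistrib)

lemma A_scale: "A (r *\<^sub>R \<tau>) x = r *\<^sub>R A \<tau> x"
  by (simp add: skewmat_scale vec_eq_iff matrix_vector_mult_def sum_distrib_left mult.assoc)

lemma A_diff: "A (\<sigma> - \<tau>) x = A \<sigma> x - A \<tau> x"
  using A_add[of "\<sigma> - \<tau>" \<tau> x] by simp

lemma bounded_bilinear_A: "bounded_bilinear A"
  unfolding bilinear_conv_bounded_bilinear[symmetric] bilinear_def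
  by (auto intro!: linearI simp: A_add A_scale matrix_vector_right_distrib matrix_vector_mult_scaleR)

lemma opnorm_nonneg: "0 \<le> mat_opnorm (Umat U \<tau>)"
  unfolding mat_opnorm_def by (rule onorm_pos_le) simp

lemma norm_A_le: "norm (A \<tau> x) \<le> mat_opnorm (Umat U \<tau>) * norm x"
proof -
  have "norm (Umat U \<tau> *v cvec x) \<le> mat_opnorm (Umat U \<tau>) * norm (cvec x)"
    unfolding mat_opnorm_def by (rule onorm) simp
  then show ?thesis by (simp add: Umat_eq_imat imat_cvec norm_ii_cvec norm_cvec)
qed

lemma opnorm_add: "mat_opnorm (Umat U (\<sigma> + \<tau>)) \<le> mat_opnorm (Umat U \<sigma>) + mat_opnorm (Umat U \<tau>)"
proof -
  have "(\<lambda>v. Umat U (\<sigma> + \<tau>) *v v) = (\<lambda>v. Umat U \<sigma> *v v + Umat U \<tau> *v v)"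
    by (simp add: Umat_def vec_eq_iff fun_eq_iff matrix_vector_mult_def algebra_simps sum.distrib)
  then show ?thesis unfolding mat_opnorm_def by (simp add: onorm_triangle)
qed

lemma opnorm_scale: "mat_opnorm (Umat U (r *\<^sub>R \<tau>)) = \<bar>r\<bar> * mat_opnorm (Umat U \<tau>)"
proof -
  have "Umat U (r *\<^sub>R \<tau>) *v v = r *\<^sub>R (Umat U \<tau> *v v)" for v
  proof -
    have "Umat U (r *\<^sub>R \<tau>) = r *\<^sub>R Umat U \<tau>"
      unfolding Umat_eq_imat skewmat_scale by (simp add: imat_def vec_eq_iff complex_eq_iff)
    then show ?thesis by (simp add: vec_eq_iff matrix_vector_mult_def scaleR_sum_right)
  qed
  then have "(\<lambda>v. Umat U (r *\<^sub>R \<tau>) *v v) = (\<lambda>v. r *\<^sub>R (Umat U \<tau> *v v))" by auto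
  then show ?thesis unfolding mat_opnorm_def by (simp add: onorm_scaleR)
qed

text \<open>The operator \<open>Z\<close> is built from an eigenbasis that depends on \<tau>; the
  existential hides this basis and exports only what is uniform, namely the bound \<open>C\<close>,
  fixed before \<tau>.\<close>

lemma phi_operator:
  assumes c: "0 < c" "c < pi"
  shows "\<exists>C\<ge>0. \<forall>\<tau>. mat_opnorm (Umat U \<tau>) \<le> c \<longrightarrow> (\<exists>Z. linear Z \<and> (\<forall>a b. Z a \<bullet> b = a \<bullet> Z b) \<and>
    (\<forall>a. norm (Z a) \<le> C * norm a) \<and> (\<forall>x t. phi U (x, t) \<tau> = Z x \<bullet> x + 4 * (t \<bullet> \<tau>)) \<and>
    (\<forall>x. \<exists>\<xi>. extremal (A \<tau>) (Z x - A \<tau> x) \<xi> \<and> \<xi> 1 = x))"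
proof (intro exI[of _ "1 + c / sin c"] conjI allI impI)
  show C: "0 \<le> 1 + c / sin c" using c sin_gt_zero[of c] by simp
  fix \<tau> assume \<tau>: "mat_opnorm (Umat U \<tau>) \<le> c"
  interpret skew_map "A \<tau>" by (rule skew_map_A)
  obtain B l where basis: "skew_eigenbasis (A \<tau>) B l" using skew_eigenbasis_exists[OF lin skew] by blast
  have l: "0 \<le> l e" "l e \<le> c" if "e \<in> B" for e
    using skew_eigenbasisD(3,5)[OF basis that] norm_A_le[of \<tau> e] \<tau> norm_ge_zero[of "A \<tau> e"] by simp_all
  let ?f = "\<lambda>e. real_zcot (l e)"
  let ?Z = "\<lambda>x. \<Sum>e\<in>B. (?f e * (x \<bullet> e)) *\<^sub>R e"
  have f: "\<forall>e\<in>B. \<bar>?f e\<bar> \<le> 1 + c / sin c"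
    using real_zcot_bounded[OF c l] by blast
  note Z = skew_eigenbasis_operator[OF basis f C]
  show "\<exists>Z. linear Z \<and> (\<forall>a b. Z a \<bullet> b = a \<bullet> Z b) \<and>
    (\<forall>a. norm (Z a) \<le> (1 + c / sin c) * norm a) \<and> (\<forall>x t. phi U (x, t) \<tau> = Z x \<bullet> x + 4 * (t \<bullet> \<tau>)) \<and>
    (\<forall>x. \<exists>\<xi>. extremal (A \<tau>) (Z x - A \<tau> x) \<xi> \<and> \<xi> 1 = x)"
  proof (intro exI[of _ ?Z] conjI allI)
    show "phi U (x, t) \<tau> = ?Z x \<bullet> x + 4 * (t \<bullet> \<tau>)" for x t
      using Z(4)[of x] phi_eigenbasis[OF transpose_skewmat basis, of x t] by simp
    show "\<exists>\<xi>. extremal (A \<tau>) (?Z x - A \<tau> x) \<xi> \<and> \<xi> 1 = x" for x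
      by (rule extremal_to_point[OF basis]) (use l c in force)
  qed (fact Z(1-3))+
qed

text \<open>One eigenbasis serves \<tau> and all its multiples, with \<open>l\<close> scaled by
  \<open>r\<close>; the quadratic part reduces to the scalar inequality and the linear part scales
  exactly.\<close>

lemma phi_scale_ge:
  assumes \<tau>: "\<tau> \<in> Omega_star U" and r: "0 < r" "r \<le> 1"
  shows "r * phi U (x, t) \<tau> \<le> phi U (x, t) (r *\<^sub>R \<tau>)"
proof -
  interpret skew_map "A \<tau>" by (rule skew_map_A)
  obtain B l where basis: "skew_eigenbasis (A \<tau>) B l" using skew_eigenbasis_exists[OF lin skew] by blast
  have basis': "skew_eigenbasis (A (r *\<^sub>R \<tau>)) B (\<lambda>e. r * l e)"
    using basis r unfolding skew_eigenbasis_def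
    by (auto simp: A_scale matrix_vector_mult_scaleR power2_eq_square algebra_simps)
  have l: "0 \<le> l e" "l e < pi" if "e \<in> B" for e
    using skew_eigenbasisD(3,5)[OF basis that] norm_A_le[of \<tau> e] \<tau> norm_ge_zero[of "A \<tau> e"]
    by (simp_all add: Omega_star_def)
  have "(\<Sum>e\<in>B. (r * real_zcot (l e)) * (x \<bullet> e)\<^sup>2) \<le> (\<Sum>e\<in>B. real_zcot (r * l e) * (x \<bullet> e)\<^sup>2)"
    using l r by (intro sum_mono mult_right_mono real_zcot_scale_ge) auto
  then show ?thesis
    unfolding phi_eigenbasis[OF transpose_skewmat basis] phi_eigenbasis[OF transpose_skewmat basis']
    by (simp add: distrib_left sum_distrib_left mult.assoc)
qed

text \<open>Linear independence enters here: it makes \<open>skewmat U\<close> injective, so \<tau>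
  is controlled by a matrix whose entries are bounded by \<pi>. Boundedness later provides
  convergent subsequences of maximisers.\<close>

lemma Omega_star_bounded:
  assumes "inj U" "independent (range U)"
  shows "bounded (Omega_star U)"
proof -
  have "linear (skewmat U)" by (intro linearI skewmat_add skewmat_scale)
  moreover have "inj (skewmat U)"
  proof (subst linear_injective_0[OF \<open>linear (skewmat U)\<close>], intro allI impI)
    fix \<tau> assume 0: "skewmat U \<tau> = 0"
    have "(\<Sum>M\<in>range U. \<tau> $ (inv U M) *\<^sub>R M) = skewmat U \<tau>"
      unfolding skewmat_def using assms(1) by (subst sum.reindex) (auto simp: inv_f_f)
    then have "(\<Sum>M\<in>range U. \<tau> $ (inv U M) *\<^sub>R M) = 0" using 0 by simp
    then have "\<tau> $ (inv U (U j)) = 0" for j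
      using independentD[OF assms(2), of "range U" "\<lambda>M. \<tau> $ (inv U M)" "U j"] by simp
    then show "\<tau> = 0" using assms(1) by (simp add: vec_eq_iff inv_f_f)
  qed
  ultimately obtain b where b: "b > 0" "\<And>\<tau>. b * norm \<tau> \<le> norm (skewmat U \<tau>)"
    using linear_inj_bounded_below_pos by blast
  have "norm \<tau> \<le> real CARD('q) * (real CARD('q) * pi) / b" if "\<tau> \<in> Omega_star U" for \<tau>
  proof -
    have entry: "\<bar>skewmat U \<tau> $ i $ j\<bar> \<le> pi" for i j
    proof -
      have "\<bar>skewmat U \<tau> $ i $ j\<bar> = \<bar>A \<tau> (axis j 1) $ i\<bar>" by (simp add: matrix_vector_mul_component inner_axis)
      also have "\<dots> \<le> norm (A \<tau> (axis j 1))" by (rule component_le_norm_cart)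
      also have "\<dots> \<le> mat_opnorm (Umat U \<tau>) * norm (axis j 1 :: real^'q)" by (rule norm_A_le)
      also have "\<dots> \<le> pi" using that by (simp add: Omega_star_def)
      finally show ?thesis .
    qed
    have "norm (skewmat U \<tau>) \<le> (\<Sum>i\<in>UNIV. norm (skewmat U \<tau> $ i))"
      unfolding norm_vec_def[of "skewmat U \<tau>"] by (rule L2_set_le_sum) simp
    also have "\<dots> \<le> (\<Sum>i\<in>(UNIV::'q set). \<Sum>j\<in>(UNIV::'q set). pi)"
      by (intro sum_mono order_trans[OF norm_le_l1_cart] entry)
    finally have "b * norm \<tau> \<le> real CARD('q) * (real CARD('q) * pi)" using b(2)[of \<tau>] by simp
    then show ?thesis using b(1) by (simp add: field_simps)
  qed
  then show ?thesis by (auto simp: bounded_iff)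
qed

end

section \<open>Endpoints of extremals\<close>

lemma lipschitz_imp_abs_cont_on:
  assumes K: "\<And>l r. \<lbrakk>a \<le> l; l \<le> r; r \<le> b\<rbrakk> \<Longrightarrow> norm (f r - f l) \<le> K * (r - l)"
  shows "abs_cont_on a b f"
  unfolding abs_cont_on_def
proof (intro allI impI)
  fix \<epsilon> :: real assume \<epsilon>: "\<epsilon> > 0"
  show "\<exists>\<delta>>0. \<forall>(n::nat) l r. (\<forall>k<n. a \<le> l k \<and> l k \<le> r k \<and> r k \<le> b) \<and>
      (\<forall>i<n. \<forall>j<n. i \<noteq> j \<longrightarrow> r i \<le> l j \<or> r j \<le> l i) \<and> (\<Sum>k<n. r k - l k) < \<delta>
      \<longrightarrow> (\<Sum>k<n. norm (f (r k) - f (l k))) < \<epsilon>"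
  proof (intro exI[of _ "\<epsilon> / (\<bar>K\<bar> + 1)"] conjI allI impI)
    show "0 < \<epsilon> / (\<bar>K\<bar> + 1)" using \<epsilon> by (simp add: add_nonneg_pos)
    fix n :: nat and l r :: "nat \<Rightarrow> real"
    assume H: "(\<forall>k<n. a \<le> l k \<and> l k \<le> r k \<and> r k \<le> b) \<and>
      (\<forall>i<n. \<forall>j<n. i \<noteq> j \<longrightarrow> r i \<le> l j \<or> r j \<le> l i) \<and> (\<Sum>k<n. r k - l k) < \<epsilon> / (\<bar>K\<bar> + 1)"
    have "(\<Sum>k<n. norm (f (r k) - f (l k))) \<le> (\<Sum>k<n. (\<bar>K\<bar> + 1) * (r k - l k))"
    proof (rule sum_mono)
      fix k assume "k \<in> {..<n}"
      then have k: "a \<le> l k" "l k \<le> r k" "r k \<le> b" using H by auto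
      have "K * (r k - l k) \<le> (\<bar>K\<bar> + 1) * (r k - l k)" using k by (intro mult_right_mono) auto
      then show "norm (f (r k) - f (l k)) \<le> (\<bar>K\<bar> + 1) * (r k - l k)" using K[OF k] by linarith
    qed
    also have "\<dots> = (\<bar>K\<bar> + 1) * (\<Sum>k<n. r k - l k)" by (simp add: sum_distrib_left)
    also have "\<dots> < \<epsilon>" using H by (simp add: pos_less_divide_eq mult.commute add_nonneg_pos)
    finally show "(\<Sum>k<n. norm (f (r k) - f (l k))) < \<epsilon>" .
  qed
qed

context step_two_group
begin

text \<open>The choice is harmless: \<open>xi_eqI\<close> determines the values on
  \<open>{0..1}\<close>, where all endpoints and lengths are taken.\<close>

definition xi :: "real^'m \<Rightarrow> real^'q \<Rightarrow> real \<Rightarrow> real^'q" where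
  "xi \<tau> w = (SOME \<xi>. extremal (A \<tau>) w \<xi>)"

definition vel :: "real^'m \<Rightarrow> real^'q \<Rightarrow> real \<Rightarrow> real^'q" where
  "vel \<tau> w s = w + 2 *\<^sub>R A \<tau> (xi \<tau> w s)"

definition vert :: "real^'m \<Rightarrow> real^'q \<Rightarrow> real \<Rightarrow> real^'m" where
  "vert \<tau> w s = (\<chi> j. (1 / 2) * ((U j *v xi \<tau> w s) \<bullet> vel \<tau> w s))"

text \<open>The point (\<open>xi \<tau> w 1\<close>, \<open>tend \<tau> w\<close>) is where the
  horizontal lift of the extremal ends: an exponential map in the initial velocity \<open>w\<close>
  and the vertical covector \<tau>.\<close>

definition tend :: "real^'m \<Rightarrow> real^'q \<Rightarrow> real^'m" where
  "tend \<tau> w = integral {0..1} (vert \<tau> w)"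

lemma extremal_xi: "extremal (A \<tau>) w (xi \<tau> w)"
  unfolding xi_def using skew_map.extremal_exists[OF skew_map_A] by (rule someI_ex)

lemma xi_eqI:
  assumes "extremal (A \<tau>) w \<xi>" "s \<in> {0..1}"
  shows "xi \<tau> w s = \<xi> s"
  using skew_map.extremal_unique[OF skew_map_A extremal_xi assms] .

lemma xi_0: "xi \<tau> w 0 = 0"
  using extremal_xi by (simp add: extremal_def)

lemma xi_has_vector_derivative: "(xi \<tau> w has_vector_derivative vel \<tau> w s) (at s)"
  using extremal_xi by (simp add: extremal_def vel_def)

lemma norm_vel: "norm (vel \<tau> w s) = norm w"
  unfolding vel_def by (rule skew_map.extremal_speed[OF skew_map_A extremal_xi])

lemma norm_xi_le: "s \<in> {0..1} \<Longrightarrow> norm (xi \<tau> w s) \<le> 2 * norm w"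
  by (rule skew_map.extremal_norm_le[OF skew_map_A extremal_xi])

lemma continuous_xi: "continuous_on S (xi \<tau> w)"
  by (meson continuous_at_imp_continuous_on has_vector_derivative_continuous xi_has_vector_derivative)

lemma continuous_vel: "continuous_on S (vel \<tau> w)"
  unfolding vel_def
  by (intro continuous_intros bounded_linear.continuous_on[OF matrix_vector_mul_bounded_linear] continuous_xi)

lemma continuous_vert: "continuous_on S (vert \<tau> w)"
  unfolding vert_def
  by (intro continuous_intros continuous_on_vec_lambda continuous_vel continuous_xi
      bounded_linear.continuous_on[OF matrix_vector_mul_bounded_linear])

lemma vert_integrable: "vert \<tau> w integrable_on {a..b}"
  by (intro integrable_continuous_interval continuous_vert)

lemma vert_inner: "vert \<tau> w s \<bullet> \<tau> = (1 / 2) * (A \<tau> (xi \<tau> w s) \<bullet> vel \<tau> w s)"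
  unfolding skewmat_inner
  by (simp add: vert_def inner_vec_def[of "\<chi> j. _ j"] sum_distrib_left mult_ac)

lemma norm_vert_le:
  assumes "s \<in> {0..1}"
  shows "norm (vert \<tau> w s) \<le> (\<Sum>j\<in>UNIV. onorm (\<lambda>x. U j *v x)) * (norm w)\<^sup>2"
proof -
  have "norm (vert \<tau> w s) \<le> (\<Sum>j\<in>UNIV. \<bar>vert \<tau> w s $ j\<bar>)" by (rule norm_le_l1_cart)
  also have "\<dots> \<le> (\<Sum>j\<in>UNIV. onorm (\<lambda>x. U j *v x) * (norm w)\<^sup>2)"
  proof (rule sum_mono)
    fix j
    have o: "0 \<le> onorm (\<lambda>x. U j *v x)" by (rule onorm_pos_le) simp
    have "\<bar>(U j *v xi \<tau> w s) \<bullet> vel \<tau> w s\<bar> \<le> norm (U j *v xi \<tau> w s) * norm w"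
      using Cauchy_Schwarz_ineq2[of "U j *v xi \<tau> w s" "vel \<tau> w s"] by (simp add: norm_vel)
    also have "\<dots> \<le> (onorm (\<lambda>x. U j *v x) * (2 * norm w)) * norm w"
    proof (rule mult_right_mono)
      have "norm (U j *v xi \<tau> w s) \<le> onorm (\<lambda>x. U j *v x) * norm (xi \<tau> w s)" by (rule onorm) simp
      also have "\<dots> \<le> onorm (\<lambda>x. U j *v x) * (2 * norm w)"
        by (rule mult_left_mono[OF norm_xi_le[OF assms] o])
      finally show "norm (U j *v xi \<tau> w s) \<le> onorm (\<lambda>x. U j *v x) * (2 * norm w)" .
    qed simp
    finally show "\<bar>vert \<tau> w s $ j\<bar> \<le> onorm (\<lambda>x. U j *v x) * (norm w)\<^sup>2"
      by (simp add: vert_def abs_mult power2_eq_square)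
  qed
  finally show ?thesis by (simp add: sum_distrib_right)
qed

lemma extremal_horizontal_curve:
  "\<exists>\<gamma> v. horizontal_curve U (xi \<tau> w 1, tend \<tau> w) \<gamma> v \<and> integral {0..1} (\<lambda>s. norm (v s)) = norm w"
proof (intro exI conjI)
  let ?p = "\<lambda>r. integral {0..r} (vert \<tau> w)"
  let ?\<gamma> = "\<lambda>s. (xi \<tau> w s, ?p s)"
  let ?M = "(\<Sum>j\<in>UNIV. onorm (\<lambda>x. U j *v x)) * (norm w)\<^sup>2"
  show "integral {0..1} (\<lambda>s. norm (vel \<tau> w s)) = norm w" by (simp add: norm_vel)
  have "norm (?\<gamma> r - ?\<gamma> l) \<le> (norm w + ?M) * (r - l)" if lr: "0 \<le> l" "l \<le> r" "r \<le> 1" for l r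
  proof -
    have "(vel \<tau> w has_integral xi \<tau> w r - xi \<tau> w l) {l..r}"
      using xi_has_vector_derivative lr
      by (intro fundamental_theorem_of_calculus) (auto intro: has_vector_derivative_at_within)
    then have "xi \<tau> w r - xi \<tau> w l = integral {l..r} (vel \<tau> w)" by (simp add: integral_unique)
    then have 1: "norm (xi \<tau> w r - xi \<tau> w l) \<le> norm w * (r - l)"
      using integral_bound[OF lr(2) continuous_vel[of _ \<tau> w], of "norm w"] by (simp add: norm_vel)
    have "?p r - ?p l = integral {l..r} (vert \<tau> w)"
      using Henstock_Kurzweil_Integration.integral_combine[OF lr(1,2) vert_integrable[of \<tau> w]]
      by (simp add: algebra_simps)
    moreover have "norm (integral {l..r} (vert \<tau> w)) \<le> ?M * (r - l)"
      using lr by (intro integral_bound continuous_vert norm_vert_le) auto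
    ultimately have 2: "norm (?p r - ?p l) \<le> ?M * (r - l)" by simp
    have "norm (?\<gamma> r - ?\<gamma> l) \<le> norm (xi \<tau> w r - xi \<tau> w l) + norm (?p r - ?p l)"
      by (simp add: norm_Pair_le)
    then show ?thesis using 1 2 by (simp add: distrib_right)
  qed
  then have ac: "abs_cont_on 0 1 ?\<gamma>" by (rule lipschitz_imp_abs_cont_on)
  \<comment> \<open>The vertical part is differentiated within \<open>{0..1}\<close>, which yields a
    two-sided derivative at interior points; the two endpoints form a null set.\<close>
  have "{0, 1::real} \<in> null_sets lebesgue" by (simp add: negligible_iff_null_sets[symmetric])
  then have "AE s in lebesgue. s \<notin> {0, 1::real}" by (rule AE_not_in)
  then have ae: "AE s in lebesgue. s \<in> {0..1} \<longrightarrow>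
      ((\<lambda>r. fst (?\<gamma> r)) has_vector_derivative vel \<tau> w s) (at s) \<and>
      ((\<lambda>r. snd (?\<gamma> r)) has_vector_derivative (\<chi> j. (1/2) * ((U j *v fst (?\<gamma> s)) \<bullet> vel \<tau> w s))) (at s)"
  proof eventually_elim
    case (elim s)
    show ?case
    proof (intro impI conjI)
      assume "s \<in> {0..1}"
      then have s: "0 < s" "s < 1" using elim by auto
      show "((\<lambda>r. fst (?\<gamma> r)) has_vector_derivative vel \<tau> w s) (at s)"
        by (simp add: xi_has_vector_derivative)
      have "(?p has_vector_derivative vert \<tau> w s) (at s within {0..1})"
        using s by (intro integral_has_vector_derivative continuous_vert) auto
      then have "(?p has_vector_derivative vert \<tau> w s) (at s)" using s by (simp add: at_within_Icc_at)
      then show "((\<lambda>r. snd (?\<gamma> r)) has_vector_derivative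
          (\<chi> j. (1/2) * ((U j *v fst (?\<gamma> s)) \<bullet> vel \<tau> w s))) (at s)"
        by (simp add: vert_def)
    qed
  qed
  have int: "(\<lambda>s. norm (vel \<tau> w s)) integrable_on {0..1}"
    by (simp add: norm_vel integrable_const_ivl)
  show "horizontal_curve U (xi \<tau> w 1, tend \<tau> w) ?\<gamma> (vel \<tau> w)"
    unfolding horizontal_curve_def using ac ae int by (simp add: xi_0 tend_def)
qed

text \<open>The equality case of \<open>curve_length_bound\<close>, valid here for every \<tau>,
  inside \<open>Omega_star U\<close> or not.\<close>

lemma energy_identity: "(norm w)\<^sup>2 = xi \<tau> w 1 \<bullet> w + 4 * (tend \<tau> w \<bullet> \<tau>)"
proof -
  have "(vert \<tau> w has_integral tend \<tau> w) {0..1}"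
    unfolding tend_def using vert_integrable by blast
  from has_integral_mult_right[OF has_integral_linear[OF this bounded_linear_inner_left[of \<tau>]], of 4]
  have "((\<lambda>s. 2 * (A \<tau> (xi \<tau> w s) \<bullet> vel \<tau> w s)) has_integral 4 * (tend \<tau> w \<bullet> \<tau>)) {0..1}"
    by (simp add: comp_def vert_inner)
  moreover have "((\<lambda>s. 2 * (A \<tau> (xi \<tau> w s) \<bullet> vel \<tau> w s)) has_integral (norm w)\<^sup>2 - xi \<tau> w 1 \<bullet> w) {0..1}"
    unfolding vel_def by (rule skew_map.extremal_energy[OF skew_map_A extremal_xi])
  ultimately have "4 * (tend \<tau> w \<bullet> \<tau>) = (norm w)\<^sup>2 - xi \<tau> w 1 \<bullet> w" by (rule has_integral_unique)
  then show ?thesis by simp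
qed

text \<open>No bound on the norm of \<tau> is imposed, so limits on the boundary of
  \<open>Omega_star U\<close> are covered.\<close>

lemma xi_tendsto:
  assumes \<tau>: "\<tau>n \<longlonglongrightarrow> \<tau>" and w: "wn \<longlonglongrightarrow> w" and s: "s \<in> {0..1}"
  shows "(\<lambda>n. xi (\<tau>n n) (wn n) s) \<longlonglongrightarrow> xi \<tau> w s"
proof -
  obtain C where C: "\<And>\<sigma> x. norm (A \<sigma> x) \<le> norm \<sigma> * norm x * C"
    using bounded_bilinear.bounded[OF bounded_bilinear_A] by blast
  have bound: "norm (xi (\<tau>n n) (wn n) s - xi \<tau> w s) \<le> 2 * (norm (wn n - w) + 4 * (norm (\<tau>n n - \<tau>) * C) * norm w)" for n
  proof (rule skew_map.extremal_stability[OF skew_map_A extremal_xi extremal_xi skew_map_A _ s])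
    show "norm (A (\<tau>n n) x - A \<tau> x) \<le> norm (\<tau>n n - \<tau>) * C * norm x" for x
      using C[of "\<tau>n n - \<tau>" x] by (simp add: A_diff mult_ac)
  qed
  have "(\<lambda>n. 2 * (norm (wn n - w) + 4 * (norm (\<tau>n n - \<tau>) * C) * norm w)) \<longlonglongrightarrow>
      2 * (norm (w - w) + 4 * (norm (\<tau> - \<tau>) * C) * norm w)"
    by (intro tendsto_intros \<tau> w)
  then have lim: "(\<lambda>n. 2 * (norm (wn n - w) + 4 * (norm (\<tau>n n - \<tau>) * C) * norm w)) \<longlonglongrightarrow> 0"
    by simp
  have "(\<lambda>n. xi (\<tau>n n) (wn n) s - xi \<tau> w s) \<longlonglongrightarrow> 0"
    by (rule Lim_null_comparison[OF _ lim]) (intro always_eventually allI bound)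
  then show ?thesis by (simp add: LIM_zero_iff)
qed

lemma tend_tendsto:
  assumes \<tau>: "\<tau>n \<longlonglongrightarrow> \<tau>" and w: "wn \<longlonglongrightarrow> w"
  shows "(\<lambda>n. tend (\<tau>n n) (wn n)) \<longlonglongrightarrow> tend \<tau> w"
proof -
  obtain W where W: "\<And>n. norm (wn n) \<le> W"
    using convergent_imp_Bseq[OF convergentI[OF w]] by (auto simp: Bseq_def)
  let ?S = "\<Sum>j\<in>UNIV. onorm (\<lambda>x. U j *v x)"
  have S: "0 \<le> ?S" by (intro sum_nonneg onorm_pos_le) simp
  show ?thesis
    unfolding tend_def
  proof (rule dominated_convergence(2)[where h = "\<lambda>_. ?S * W\<^sup>2"])
    show "norm (vert (\<tau>n n) (wn n) s) \<le> ?S * W\<^sup>2" if "s \<in> {0..1}" for n s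
      by (rule order_trans[OF norm_vert_le[OF that]])
        (intro mult_left_mono power_mono W S norm_ge_zero)
    show "(\<lambda>n. vert (\<tau>n n) (wn n) s) \<longlonglongrightarrow> vert \<tau> w s" if s: "s \<in> {0..1}" for s
      unfolding vert_def vel_def
      by (intro tendsto_vec_lambda tendsto_intros w \<tau> xi_tendsto[OF \<tau> w s]
          bounded_linear.tendsto[OF matrix_vector_mul_bounded_linear]
          bounded_bilinear.tendsto[OF bounded_bilinear_A])
  qed (auto intro: vert_integrable)
qed

lemma Omega_starD:
  assumes "\<tau> \<in> Omega_star U"
  obtains c where "0 < c" "c < pi" "mat_opnorm (Umat U \<tau>) \<le> c"
proof (rule that)
  show "0 < (mat_opnorm (Umat U \<tau>) + pi) / 2" "(mat_opnorm (Umat U \<tau>) + pi) / 2 < pi"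
    "mat_opnorm (Umat U \<tau>) \<le> (mat_opnorm (Umat U \<tau>) + pi) / 2"
    using assms opnorm_nonneg[of \<tau>] pi_gt_zero unfolding Omega_star_def by auto
qed

lemma xi_end_eq:
  assumes "extremal (A \<tau>) w \<xi>" "\<xi> 1 = x"
  shows "xi \<tau> w 1 = x"
  using xi_eqI[OF assms(1), of 1] assms(2) by simp

text \<open>The endpoint is linear in \<open>w\<close>, and \<open>phi_operator\<close> supplies an
  initial velocity for every endpoint; a linear surjection of a finite-dimensional space onto itself
  is injective. This identifies limits of initial velocities.\<close>

lemma xi_end_inj:
  assumes "\<tau> \<in> Omega_star U"
  shows "inj (\<lambda>w. xi \<tau> w 1)"
proof -
  have "linear (\<lambda>w. xi \<tau> w 1)"
  proof (rule linearI)
    show "xi \<tau> (r *\<^sub>R w) 1 = r *\<^sub>R xi \<tau> w 1" for r w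
      by (rule xi_end_eq[OF extremal_scaleR[OF skew_map.lin[OF skew_map_A] extremal_xi]]) simp
    show "xi \<tau> (w + w') 1 = xi \<tau> w 1 + xi \<tau> w' 1" for w w'
      by (rule xi_end_eq[OF extremal_add[OF skew_map.lin[OF skew_map_A] extremal_xi extremal_xi]]) simp
  qed
  moreover have "surj (\<lambda>w. xi \<tau> w 1)"
  proof -
    obtain c where c: "0 < c" "c < pi" "mat_opnorm (Umat U \<tau>) \<le> c" using Omega_starD[OF assms] .
    from phi_operator[OF c(1,2)] c(3) obtain Z
      where "\<And>x. \<exists>\<xi>. extremal (A \<tau>) (Z x - A \<tau> x) \<xi> \<and> \<xi> 1 = x" by blast
    then have "xi \<tau> (Z x - A \<tau> x) 1 = x" for x using xi_end_eq by blast
    then show ?thesis by (rule surjI)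
  qed
  ultimately show ?thesis by (intro linear_surjective_imp_injective) auto
qed

lemma phi_le_length_square:
  assumes "\<tau> \<in> Omega_star U" "horizontal_curve U (x, t) \<gamma> v"
  shows "phi U (x, t) \<tau> \<le> (integral {0..1} (\<lambda>s. norm (v s)))\<^sup>2"
proof -
  obtain c where c: "0 < c" "c < pi" "mat_opnorm (Umat U \<tau>) \<le> c" using Omega_starD[OF assms(1)] .
  from phi_operator[OF c(1,2)] c(3) obtain Z
    where phi: "phi U (x, t) \<tau> = Z x \<bullet> x + 4 * (t \<bullet> \<tau>)"
      and "\<exists>\<xi>. extremal (A \<tau>) (Z x - A \<tau> x) \<xi> \<and> \<xi> 1 = x" by blast
  then obtain \<xi> where \<xi>: "extremal (A \<tau>) (Z x - A \<tau> x) \<xi>" "\<xi> 1 = x" by blast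
  have "norm (A \<tau> y) \<le> c * norm y" for y
    by (rule order_trans[OF norm_A_le]) (intro mult_right_mono c norm_ge_zero)
  from curve_length_bound[OF assms(2) skew_map_A this c(1,2) \<xi>]
  show ?thesis
    using skew_map.inner_self[OF skew_map_A[of \<tau>], of x] by (simp add: phi inner_diff_right inner_commute)
qed

end

section \<open>From maximisers of \<open>phi\<close> to points in the closure, and comparison with
  the distance\<close>

context step_two_group
begin

text \<open>For fixed \<open>x\<close> and \<tau> a single extremal serves all \<open>t\<close>:
  \<open>phi\<close> is its squared length corrected by the mismatch between \<open>t\<close> and
  the height it actually reaches.\<close>

lemma phi_extremal:
  assumes c: "0 < c" "c < pi"
  shows "\<exists>C. \<forall>\<tau> x. mat_opnorm (Umat U \<tau>) \<le> c \<longrightarrow> (\<exists>w. xi \<tau> w 1 = x \<and> norm w \<le> C * norm x \<and>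
    (\<forall>t. phi U (x, t) \<tau> = (norm w)\<^sup>2 + 4 * ((t - tend \<tau> w) \<bullet> \<tau>)))"
proof -
  obtain C where C: "\<forall>\<tau>. mat_opnorm (Umat U \<tau>) \<le> c \<longrightarrow> (\<exists>Z. linear Z \<and> (\<forall>a b. Z a \<bullet> b = a \<bullet> Z b) \<and>
    (\<forall>a. norm (Z a) \<le> C * norm a) \<and> (\<forall>x t. phi U (x, t) \<tau> = Z x \<bullet> x + 4 * (t \<bullet> \<tau>)) \<and>
    (\<forall>x. \<exists>\<xi>. extremal (A \<tau>) (Z x - A \<tau> x) \<xi> \<and> \<xi> 1 = x))"
    using phi_operator[OF c] by blast
  show ?thesis
  proof (intro exI[of _ "C + c"] allI impI)
    fix \<tau> x assume \<tau>: "mat_opnorm (Umat U \<tau>) \<le> c"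
    then obtain Z where Z: "norm (Z x) \<le> C * norm x" "\<And>t. phi U (x, t) \<tau> = Z x \<bullet> x + 4 * (t \<bullet> \<tau>)"
      "\<exists>\<xi>. extremal (A \<tau>) (Z x - A \<tau> x) \<xi> \<and> \<xi> 1 = x" using C by blast
    let ?w = "Z x - A \<tau> x"
    have x: "xi \<tau> ?w 1 = x" using Z(3) xi_end_eq by blast
    have "norm (A \<tau> x) \<le> c * norm x"
      by (rule order_trans[OF norm_A_le]) (intro mult_right_mono \<tau> norm_ge_zero)
    then have "norm ?w \<le> (C + c) * norm x"
      using norm_triangle_ineq4[of "Z x" "A \<tau> x"] Z(1) by (simp add: distrib_right)
    moreover have "phi U (x, t) \<tau> = (norm ?w)\<^sup>2 + 4 * ((t - tend \<tau> ?w) \<bullet> \<tau>)" for t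
    proof -
      have "x \<bullet> ?w = Z x \<bullet> x"
        using skew_map.inner_self[OF skew_map_A[of \<tau>], of x] by (simp add: inner_diff_right inner_commute)
      then show ?thesis
        using energy_identity[of ?w \<tau>] by (simp add: x Z(2) inner_diff_left)
    qed
    ultimately show "\<exists>w. xi \<tau> w 1 = x \<and> norm w \<le> (C + c) * norm x \<and>
        (\<forall>t. phi U (x, t) \<tau> = (norm w)\<^sup>2 + 4 * ((t - tend \<tau> w) \<bullet> \<tau>))"
      using x by blast
  qed
qed

text \<open>For \<open>\<sigma>\<close> near the maximiser \<open>\<tau>\<close>, comparing the \<open>\<sigma>\<close>-extremal to \<open>x\<close> with the bound at \<open>\<tau>\<close> gives
  \<open>phi (\<sigma>) - phi (\<tau>) \<ge> 4 (t - tend \<sigma> w) \<bullet> (\<sigma> - \<tau>)\<close>; this stands in for the gradient of \<open>phi\<close>.\<close>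

lemma maximizer_extremal:
  assumes \<tau>: "\<tau> \<in> Omega_star U"
    and max: "\<forall>\<sigma>\<in>Omega_star U. phi U (x, t) \<sigma> \<le> phi U (x, t) \<tau>"
  shows "\<exists>w. xi \<tau> w 1 = x \<and> tend \<tau> w = t \<and> phi U (x, t) \<tau> = (norm w)\<^sup>2"
proof -
  define c where "c = (mat_opnorm (Umat U \<tau>) + pi) / 2"
  have op: "mat_opnorm (Umat U \<tau>) < c" and c: "0 < c" "c < pi"
    using \<tau> opnorm_nonneg[of \<tau>] pi_gt_zero unfolding Omega_star_def c_def by auto
  obtain C where C: "\<forall>\<tau> x. mat_opnorm (Umat U \<tau>) \<le> c \<longrightarrow> (\<exists>w. xi \<tau> w 1 = x \<and> norm w \<le> C * norm x \<and>
      (\<forall>t. phi U (x, t) \<tau> = (norm w)\<^sup>2 + 4 * ((t - tend \<tau> w) \<bullet> \<tau>)))"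
    using phi_extremal[OF c] by blast
  obtain w where w: "xi \<tau> w 1 = x" "\<And>t. phi U (x, t) \<tau> = (norm w)\<^sup>2 + 4 * ((t - tend \<tau> w) \<bullet> \<tau>)"
    using C op by (meson less_imp_le)
  \<comment> \<open>The mismatch to be shown zero is itself taken as the direction in which \<tau>
    is perturbed.\<close>
  define \<sigma> where "\<sigma> = t - tend \<tau> w"
  \<comment> \<open>Small enough to keep all perturbed parameters at norm at most \<open>c\<close>,
    so that one constant \<open>C\<close> bounds all their initial velocities.\<close>
  define \<epsilon> where "\<epsilon> = (c - mat_opnorm (Umat U \<tau>)) / (1 + mat_opnorm (Umat U \<sigma>))"
  have \<epsilon>: "\<epsilon> > 0" "\<epsilon> * mat_opnorm (Umat U \<sigma>) \<le> c - mat_opnorm (Umat U \<tau>)"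
    using op opnorm_nonneg[of \<sigma>] by (auto simp: \<epsilon>_def field_simps add_pos_nonneg)
  define \<tau>n where "\<tau>n n = \<tau> + (\<epsilon> * inverse (real (Suc n))) *\<^sub>R \<sigma>" for n
  have opn: "mat_opnorm (Umat U (\<tau>n n)) \<le> c" for n
  proof -
    have "mat_opnorm (Umat U (\<tau>n n)) \<le> mat_opnorm (Umat U \<tau>)
        + \<epsilon> * inverse (real (Suc n)) * mat_opnorm (Umat U \<sigma>)"
      using opnorm_add[of \<tau> "(\<epsilon> * inverse (real (Suc n))) *\<^sub>R \<sigma>"] \<epsilon>(1)
      by (simp add: \<tau>n_def opnorm_scale)
    also have "\<epsilon> * inverse (real (Suc n)) * mat_opnorm (Umat U \<sigma>) \<le> \<epsilon> * 1 * mat_opnorm (Umat U \<sigma>)"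
      using \<epsilon>(1) opnorm_nonneg by (intro mult_right_mono mult_left_mono) (auto simp: field_simps)
    finally show ?thesis using \<epsilon>(2) by simp
  qed
  have \<tau>nO: "\<tau>n n \<in> Omega_star U" for n using opn[of n] c by (simp add: Omega_star_def)
  have "\<forall>n. \<exists>w. xi (\<tau>n n) w 1 = x \<and> norm w \<le> C * norm x \<and>
      (\<forall>t. phi U (x, t) (\<tau>n n) = (norm w)\<^sup>2 + 4 * ((t - tend (\<tau>n n) w) \<bullet> \<tau>n n))"
    using C opn by blast
  then obtain wn where wn: "\<And>n. xi (\<tau>n n) (wn n) 1 = x" "\<And>n. norm (wn n) \<le> C * norm x"
    "\<And>n t. phi U (x, t) (\<tau>n n) = (norm (wn n))\<^sup>2 + 4 * ((t - tend (\<tau>n n) (wn n)) \<bullet> \<tau>n n)" by metis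
  have neg: "(t - tend (\<tau>n n) (wn n)) \<bullet> \<sigma> \<le> 0" for n
  proof -
    let ?p = "tend (\<tau>n n) (wn n)"
    obtain \<gamma> v where "horizontal_curve U (x, ?p) \<gamma> v" "integral {0..1} (\<lambda>s. norm (v s)) = norm (wn n)"
      using extremal_horizontal_curve[of "\<tau>n n" "wn n"] by (auto simp: wn(1))
    then have "phi U (x, ?p) \<tau> \<le> (norm (wn n))\<^sup>2" using phi_le_length_square[OF \<tau>] by metis
    moreover have "phi U (x, t) \<tau> = phi U (x, ?p) \<tau> + 4 * ((t - ?p) \<bullet> \<tau>)"
      by (simp add: w(2) inner_diff_left)
    moreover have "phi U (x, t) (\<tau>n n) \<le> phi U (x, t) \<tau>" using max \<tau>nO by blast
    ultimately have "(t - ?p) \<bullet> \<tau>n n \<le> (t - ?p) \<bullet> \<tau>" using wn(3)[of t n] by linarith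
    then have "(\<epsilon> * inverse (real (Suc n))) * ((t - ?p) \<bullet> \<sigma>) \<le> 0"
      by (simp add: \<tau>n_def inner_add_right)
    then show ?thesis using \<epsilon>(1) by (auto simp: mult_le_0_iff)
  qed
  have "bounded (range wn)" using wn(2) by (auto simp: bounded_iff)
  then obtain w' r where r: "strict_mono (r :: nat \<Rightarrow> nat)" and w': "(wn \<circ> r) \<longlonglongrightarrow> w'"
    using bounded_imp_convergent_subsequence by blast
  have "(\<lambda>n. \<tau> + (\<epsilon> * inverse (real (Suc n))) *\<^sub>R \<sigma>) \<longlonglongrightarrow> \<tau> + (\<epsilon> * 0) *\<^sub>R \<sigma>"
    by (intro tendsto_intros LIMSEQ_inverse_real_of_nat)
  then have "\<tau>n \<longlonglongrightarrow> \<tau>" by (simp add: \<tau>n_def[abs_def])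
  then have \<tau>r: "(\<tau>n \<circ> r) \<longlonglongrightarrow> \<tau>" using r by (rule LIMSEQ_subseq_LIMSEQ)
  have "(\<lambda>n. xi ((\<tau>n \<circ> r) n) ((wn \<circ> r) n) 1) \<longlonglongrightarrow> xi \<tau> w' 1"
    by (rule xi_tendsto[OF \<tau>r w']) simp
  then have "(\<lambda>n::nat. x) \<longlonglongrightarrow> xi \<tau> w' 1" by (simp add: wn(1))
  then have "xi \<tau> w' 1 = x" by (simp add: LIMSEQ_const_iff)
  \<comment> \<open>The extremals of the perturbed parameters thus converge to the one for \<tau>.
    Passing to the limit in \<open>neg\<close> gives that \<sigma> has nonpositive square.\<close>
  then have "w' = w" using injD[OF xi_end_inj[OF \<tau>]] w(1) by metis
  then have "(\<lambda>n. (t - tend ((\<tau>n \<circ> r) n) ((wn \<circ> r) n)) \<bullet> \<sigma>) \<longlonglongrightarrow> (t - tend \<tau> w) \<bullet> \<sigma>"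
    using w' by (intro tendsto_intros tend_tendsto \<tau>r) (simp add: comp_def)
  then have "(t - tend \<tau> w) \<bullet> \<sigma> \<le> 0" by (rule LIMSEQ_le_const2) (use neg in auto)
  then have "\<sigma> = 0" unfolding \<sigma>_def[symmetric] by (metis antisym inner_eq_zero_iff inner_ge_zero)
  then have "tend \<tau> w = t" by (simp add: \<sigma>_def)
  then show ?thesis using w by auto
qed

text \<open>Symmetry of \<open>Z\<close> factors the difference of the quadratic forms as
  \<open>Z (x' - x) \<bullet> (x' + x)\<close>. The modulus is uniform only for norms at most
  \<open>c < pi\<close>, which is why parameters are rescaled before points are moved.\<close>

lemma phi_continuity_bound:
  assumes c: "0 < c" "c < pi"
  shows "\<exists>C. \<forall>\<tau> x x' t t'. mat_opnorm (Umat U \<tau>) \<le> c \<longrightarrow>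
    phi U (x', t') \<tau> \<le> phi U (x, t) \<tau> + C * norm (x' - x) * norm (x' + x) + 4 * norm (t' - t) * norm \<tau>"
proof -
  obtain C where C: "\<forall>\<tau>. mat_opnorm (Umat U \<tau>) \<le> c \<longrightarrow> (\<exists>Z. linear Z \<and> (\<forall>a b. Z a \<bullet> b = a \<bullet> Z b) \<and>
    (\<forall>a. norm (Z a) \<le> C * norm a) \<and> (\<forall>x t. phi U (x, t) \<tau> = Z x \<bullet> x + 4 * (t \<bullet> \<tau>)) \<and>
    (\<forall>x. \<exists>\<xi>. extremal (A \<tau>) (Z x - A \<tau> x) \<xi> \<and> \<xi> 1 = x))"
    using phi_operator[OF c] by blast
  show ?thesis
  proof (intro exI[of _ C] allI impI)
    fix \<tau> x x' t t' assume "mat_opnorm (Umat U \<tau>) \<le> c"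
    then obtain Z where Z: "linear Z" "\<And>a b. Z a \<bullet> b = a \<bullet> Z b" "\<And>a. norm (Z a) \<le> C * norm a"
      "\<And>x t. phi U (x, t) \<tau> = Z x \<bullet> x + 4 * (t \<bullet> \<tau>)" using C by blast
    have "Z x' \<bullet> x' - Z x \<bullet> x = Z (x' - x) \<bullet> (x' + x)"
      using Z(2)[of x x'] by (simp add: linear_diff[OF Z(1)] inner_simps inner_commute)
    also have "\<dots> \<le> norm (Z (x' - x)) * norm (x' + x)" by (rule norm_cauchy_schwarz)
    also have "\<dots> \<le> C * norm (x' - x) * norm (x' + x)" by (intro mult_right_mono Z norm_ge_zero)
    finally have "Z x' \<bullet> x' - Z x \<bullet> x \<le> C * norm (x' - x) * norm (x' + x)" .
    moreover have "t' \<bullet> \<tau> - t \<bullet> \<tau> \<le> norm (t' - t) * norm \<tau>"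
      using norm_cauchy_schwarz[of "t' - t" \<tau>] by (simp add: inner_diff_left)
    ultimately show "phi U (x', t') \<tau>
        \<le> phi U (x, t) \<tau> + C * norm (x' - x) * norm (x' + x) + 4 * norm (t' - t) * norm \<tau>"
      by (simp add: Z(4))
  qed
qed

lemma cc_dist_le:
  assumes "horizontal_curve U g \<gamma> v"
  shows "cc_dist U g \<le> integral {0..1} (\<lambda>s. norm (v s))"
  unfolding cc_dist_def
proof (rule cInf_lower)
  show "bdd_below {integral {0..1} (\<lambda>s. norm (v s)) |\<gamma> v. horizontal_curve U g \<gamma> v}"
    by (rule bdd_belowI[of _ 0])
      (auto simp: horizontal_curve_def intro!: integral_nonneg)
qed (use assms in blast)

text \<open>A horizontal curve to \<open>g\<close> is assumed because \<open>cc_dist\<close> is a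
  real infimum, whose value on the empty set carries no information.\<close>

lemma phi_le_cc_dist_square:
  assumes \<tau>: "\<tau> \<in> Omega_star U" and ex: "horizontal_curve U g \<gamma> v"
  shows "0 \<le> cc_dist U g" "phi U g \<tau> \<le> (cc_dist U g)\<^sup>2"
proof -
  let ?L = "{integral {0..1} (\<lambda>s. norm (v s)) |\<gamma> v. horizontal_curve U g \<gamma> v}"
  have ne: "?L \<noteq> {}" using ex by blast
  show nonneg: "0 \<le> cc_dist U g"
    unfolding cc_dist_def
    by (rule cInf_greatest[OF ne]) (auto simp: horizontal_curve_def intro!: integral_nonneg)
  show "phi U g \<tau> \<le> (cc_dist U g)\<^sup>2"
  proof (cases "phi U g \<tau> \<le> 0")
    case True
    then show ?thesis by (meson order_trans zero_le_power2)
  next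
    case False
    have "sqrt (phi U g \<tau>) \<le> cc_dist U g"
      unfolding cc_dist_def
    proof (rule cInf_greatest[OF ne])
      fix L assume "L \<in> ?L"
      then obtain \<gamma> v where L: "L = integral {0..1} (\<lambda>s. norm (v s))" "horizontal_curve U g \<gamma> v" by blast
      have "0 \<le> L" unfolding L(1) using L(2) by (auto simp: horizontal_curve_def intro!: integral_nonneg)
      moreover have "phi U g \<tau> \<le> L\<^sup>2"
        using phi_le_length_square[OF \<tau>, of "fst g" "snd g"] L by simp
      ultimately show "sqrt (phi U g \<tau>) \<le> L" by (rule real_le_lsqrt)
    qed
    then have "(sqrt (phi U g \<tau>))\<^sup>2 \<le> (cc_dist U g)\<^sup>2" using False by (intro power_mono) auto
    then show ?thesis using False by simp
  qed
qed

text \<open>The limiting \<tau> may lie on the boundary, so the conclusion speaks of the extremal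
  and of upper bounds of \<open>phi\<close> on \<open>Omega_star U\<close>, not of a value of
  \<open>phi\<close> at \<tau>.\<close>

lemma closure_Mtilde_extremal:
  assumes indep: "inj U" "independent (range U)" and g: "(x, t) \<in> closure (Mtilde U)"
  shows "\<exists>\<tau> w. xi \<tau> w 1 = x \<and> tend \<tau> w = t \<and>
    (\<forall>b. (\<forall>\<sigma>\<in>Omega_star U. phi U (x, t) \<sigma> \<le> b) \<longrightarrow> (norm w)\<^sup>2 \<le> b)"
proof -
  obtain gn where gM: "\<And>n. gn n \<in> Mtilde U" and gn: "gn \<longlonglongrightarrow> (x, t)"
    using g unfolding closure_sequential by blast
  define xn where "xn n = fst (gn n)" for n
  define tn where "tn n = snd (gn n)" for n
  have xn: "xn \<longlonglongrightarrow> x" and tn: "tn \<longlonglongrightarrow> t"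
    using tendsto_fst[OF gn] tendsto_snd[OF gn] by (simp_all add: xn_def[abs_def] tn_def[abs_def])
  have "\<exists>\<tau> w. \<tau> \<in> Omega_star U \<and> xi \<tau> w 1 = xn n \<and> tend \<tau> w = tn n \<and> phi U (xn n, tn n) \<tau> = (norm w)\<^sup>2" for n
  proof -
    obtain \<tau> where \<tau>: "\<tau> \<in> Omega_star U"
      "\<forall>\<sigma>\<in>Omega_star U. phi U (xn n, tn n) \<sigma> \<le> phi U (xn n, tn n) \<tau>"
      using gM[of n] by (auto simp: Mtilde_def xn_def tn_def)
    then show ?thesis using maximizer_extremal[OF \<tau>] by blast
  qed
  then obtain \<tau>n wn where \<tau>n: "\<And>n. \<tau>n n \<in> Omega_star U" and wn: "\<And>n. xi (\<tau>n n) (wn n) 1 = xn n"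
    "\<And>n. tend (\<tau>n n) (wn n) = tn n" "\<And>n. phi U (xn n, tn n) (\<tau>n n) = (norm (wn n))\<^sup>2" by metis
  obtain R where R: "\<And>n. norm (\<tau>n n) \<le> R"
    using Omega_star_bounded[OF indep] \<tau>n unfolding bounded_iff by blast
  obtain X where X: "\<And>n. norm (xn n) \<le> X"
    using convergent_imp_Bseq[OF convergentI[OF xn]] by (auto simp: Bseq_def)
  obtain T where T: "\<And>n. norm (tn n) \<le> T"
    using convergent_imp_Bseq[OF convergentI[OF tn]] by (auto simp: Bseq_def)
  have nn: "0 \<le> X" "0 \<le> T" "0 \<le> R" using X[of 0] T[of 0] R[of 0] norm_ge_zero order_trans by blast+
  have wb: "norm (wn n) \<le> X + 4 * (T * R) + 1" for n
  proof (rule ccontr)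
    let ?a = "norm (wn n)"
    assume a: "\<not> ?a \<le> X + 4 * (T * R) + 1"
    have "xn n \<bullet> wn n \<le> X * ?a"
      by (rule order_trans[OF norm_cauchy_schwarz]) (intro mult_right_mono X norm_ge_zero)
    moreover have "tn n \<bullet> \<tau>n n \<le> T * R"
      by (rule order_trans[OF norm_cauchy_schwarz]) (intro mult_mono T R nn norm_ge_zero)
    ultimately have "?a\<^sup>2 \<le> X * ?a + 4 * (T * R)"
      using energy_identity[of "wn n" "\<tau>n n"] wn by simp
    then have "?a * (?a - X) \<le> 4 * (T * R)" by (simp add: power2_eq_square algebra_simps)
    moreover have "1 * (?a - X) \<le> ?a * (?a - X)"
      using a nn by (intro mult_right_mono) (smt (verit) mult_nonneg_nonneg)+
    ultimately have "1 * (?a - X) \<le> 4 * (T * R)" by (rule order_trans[rotated])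
    then show False using a by simp
  qed
  have "bounded (range (\<lambda>n. (\<tau>n n, wn n)))"
    unfolding bounded_iff
  proof (intro exI ballI)
    fix p assume "p \<in> range (\<lambda>n. (\<tau>n n, wn n))"
    then obtain n where "p = (\<tau>n n, wn n)" by blast
    then show "norm p \<le> R + (X + 4 * (T * R) + 1)"
      using norm_Pair_le[of "\<tau>n n" "wn n"] R[of n] wb[of n] by simp
  qed
  then obtain p r where r: "strict_mono (r :: nat \<Rightarrow> nat)" and p: "((\<lambda>n. (\<tau>n n, wn n)) \<circ> r) \<longlonglongrightarrow> p"
    using bounded_imp_convergent_subsequence by blast
  define \<tau> where "\<tau> = fst p"
  define w where "w = snd p"
  have \<tau>r: "(\<lambda>n. \<tau>n (r n)) \<longlonglongrightarrow> \<tau>" and wr: "(\<lambda>n. wn (r n)) \<longlonglongrightarrow> w"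
    using tendsto_fst[OF p] tendsto_snd[OF p] by (simp_all add: \<tau>_def w_def comp_def)
  have xr: "(\<lambda>n. xn (r n)) \<longlonglongrightarrow> x" and tr: "(\<lambda>n. tn (r n)) \<longlonglongrightarrow> t"
    using LIMSEQ_subseq_LIMSEQ[OF xn r] LIMSEQ_subseq_LIMSEQ[OF tn r] by (simp_all add: comp_def)
  have "(\<lambda>n. xn (r n)) \<longlonglongrightarrow> xi \<tau> w 1" using xi_tendsto[OF \<tau>r wr, of 1] by (simp add: wn)
  then have 1: "xi \<tau> w 1 = x" using LIMSEQ_unique xr by blast
  have "(\<lambda>n. tn (r n)) \<longlonglongrightarrow> tend \<tau> w" using tend_tendsto[OF \<tau>r wr] by (simp add: wn)
  then have 2: "tend \<tau> w = t" using LIMSEQ_unique tr by blast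
  have 3: "(norm w)\<^sup>2 \<le> b" if b: "\<forall>\<sigma>\<in>Omega_star U. phi U (x, t) \<sigma> \<le> b" for b
  proof (rule field_le_mult_one_interval)
    fix \<rho> :: real assume \<rho>: "0 < \<rho>" "\<rho> < 1"
    \<comment> \<open>After scaling by \<rho> all parameters obey one bound below \<pi>, so moving
      from \<open>(xn n, tn n)\<close> to \<open>(x, t)\<close> costs an amount that tends to 0
      uniformly. The lost factor \<rho> is recovered since \<rho> < 1 is arbitrary.\<close>
    define c where "c = \<rho> * pi"
    have c: "0 < c" "c < pi" using \<rho> by (auto simp: c_def)
    have op: "mat_opnorm (Umat U (\<rho> *\<^sub>R \<tau>n n)) \<le> c" for n
      unfolding opnorm_scale c_def using \<rho> \<tau>n[of n] by (auto simp: Omega_star_def)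
    obtain C where C: "\<And>\<tau> x x' t t'. mat_opnorm (Umat U \<tau>) \<le> c \<Longrightarrow>
        phi U (x', t') \<tau> \<le> phi U (x, t) \<tau> + C * norm (x' - x) * norm (x' + x) + 4 * norm (t' - t) * norm \<tau>"
      using phi_continuity_bound[OF c] by blast
    have le: "\<rho> * (norm (wn n))\<^sup>2 \<le> b + C * norm (xn n - x) * norm (xn n + x) + 4 * norm (tn n - t) * R" for n
    proof -
      have "\<rho> * (norm (wn n))\<^sup>2 \<le> phi U (xn n, tn n) (\<rho> *\<^sub>R \<tau>n n)"
        using phi_scale_ge[OF \<tau>n, of \<rho> "xn n" "tn n" n] \<rho> by (simp add: wn)
      also have "\<dots> \<le> phi U (x, t) (\<rho> *\<^sub>R \<tau>n n) + C * norm (xn n - x) * norm (xn n + x)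
          + 4 * norm (tn n - t) * norm (\<rho> *\<^sub>R \<tau>n n)"
        by (rule C[OF op])
      also have "phi U (x, t) (\<rho> *\<^sub>R \<tau>n n) \<le> b"
        using b op[of n] c by (auto simp: Omega_star_def)
      also have "4 * norm (tn n - t) * norm (\<rho> *\<^sub>R \<tau>n n) \<le> 4 * norm (tn n - t) * R"
      proof (rule mult_left_mono)
        have "norm (\<rho> *\<^sub>R \<tau>n n) \<le> 1 * norm (\<tau>n n)"
          unfolding norm_scaleR using \<rho> by (intro mult_right_mono) auto
        then show "norm (\<rho> *\<^sub>R \<tau>n n) \<le> R" using R[of n] by simp
      qed simp
      finally show ?thesis by simp
    qed
    have "(\<lambda>n. \<rho> * (norm (wn (r n)))\<^sup>2 - C * norm (xn (r n) - x) * norm (xn (r n) + x)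
        - 4 * norm (tn (r n) - t) * R)
      \<longlonglongrightarrow> \<rho> * (norm w)\<^sup>2 - C * norm (x - x) * norm (x + x) - 4 * norm (t - t) * R"
      by (intro tendsto_intros wr xr tr)
    then have lim: "(\<lambda>n. \<rho> * (norm (wn (r n)))\<^sup>2 - C * norm (xn (r n) - x) * norm (xn (r n) + x)
        - 4 * norm (tn (r n) - t) * R) \<longlonglongrightarrow> \<rho> * (norm w)\<^sup>2" by simp
    show "\<rho> * (norm w)\<^sup>2 \<le> b"
      by (rule LIMSEQ_le_const2[OF lim]) (use le in \<open>auto simp: algebra_simps\<close>)
  qed
  show ?thesis using 1 2 3 by blast
qed

end

text \<open>With the supremum taken in \<open>ereal\<close>, the identity includes the finiteness of
  the supremum instead of resting on the default value of a real \<open>Sup\<close>.\<close>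

theorem theorem2p9:
  fixes U :: "'m::finite \<Rightarrow> (real^'q::finite^'q)"
    and g :: "(real^'q) \<times> (real^'m)"
  assumes skew: "\<And>j. transpose (U j) = - U j"
    and lin_indep: "inj U" "independent (range U)"
    and g_in: "g \<in> closure (Mtilde U)"
  shows "ereal ((cc_dist U g)\<^sup>2) = (SUP \<tau>\<in>Omega_star U. ereal (phi U g \<tau>))"
proof -
  interpret step_two_group U by (rule step_two_group.intro) (rule skew)
  obtain x t where g: "g = (x, t)" by (cases g)
  obtain \<tau> w where w: "xi \<tau> w 1 = x" "tend \<tau> w = t"
    and le: "\<And>b. \<forall>\<sigma>\<in>Omega_star U. phi U g \<sigma> \<le> b \<Longrightarrow> (norm w)\<^sup>2 \<le> b"
    using closure_Mtilde_extremal[OF lin_indep, of x t] g_in g by blast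
  obtain \<gamma> v where \<gamma>: "horizontal_curve U g \<gamma> v" and len: "integral {0..1} (\<lambda>s. norm (v s)) = norm w"
    using extremal_horizontal_curve[of \<tau> w] by (auto simp: w g)
  \<comment> \<open>A member of \<open>Omega_star U\<close> is needed to obtain
    \<open>0 \<le> cc_dist U g\<close> from the comparison lemma, and again to exclude a supremum of
    minus infinity.\<close>
  have "mat_opnorm (Umat U 0) = 0" using opnorm_scale[of 0 0] by simp
  then have \<Omega>0: "0 \<in> Omega_star U" by (simp add: Omega_star_def)
  have d: "(cc_dist U g)\<^sup>2 \<le> (norm w)\<^sup>2"
    using cc_dist_le[OF \<gamma>] phi_le_cc_dist_square(1)[OF \<Omega>0 \<gamma>] len by (intro power_mono) auto
  show ?thesis
  proof (rule antisym)
    show "(SUP \<tau>\<in>Omega_star U. ereal (phi U g \<tau>)) \<le> ereal ((cc_dist U g)\<^sup>2)"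
      using phi_le_cc_dist_square(2)[OF _ \<gamma>] by (intro SUP_least) simp
    have upper: "ereal (phi U g \<sigma>) \<le> (SUP \<tau>\<in>Omega_star U. ereal (phi U g \<tau>))" if "\<sigma> \<in> Omega_star U" for \<sigma>
      by (rule SUP_upper[OF that])
    show "ereal ((cc_dist U g)\<^sup>2) \<le> (SUP \<tau>\<in>Omega_star U. ereal (phi U g \<tau>))"
    proof (cases "SUP \<tau>\<in>Omega_star U. ereal (phi U g \<tau>)")
      case (real b)
      then have "(norm w)\<^sup>2 \<le> b" using upper by (intro le) simp
      then show ?thesis using d real by simp
    next
      case MInf
      then show ?thesis using upper[OF \<Omega>0] by simp
    qed simp
  qed
qed

end
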